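(* For every $n\ge1$, the poset $\mathcal{FL}yn_n^w$ of bicolored Lyndon forests is a Whitney dual of $\Pi_n^w$. In particular, $\mathcal{FL}yn_n^w\cong R_{\lambda_w}(\Pi_n^w)$.
   Context: Weighted partitions: a weighted set is $A^v$ with $A$ nonempty finite and $v\in\{0,\dots,|A|-1\}$; a weighted partition of $[n]$ is a collection of weighted sets whose underlying sets partition $[n]$. In $\Pi_n^w$, $\pi\lessdot\pi'$ when $\pi'$ is obtained by replacing two blocks $A^a,B^b$ by $(A\cup B)^{a+b+u}$, $u\in\{0,1\}$; $\hat0=\{1\}^0/\cdots/\{n\}^0$. The labeling $\lambda_w$ assigns to this cover (with $\min A<\min B$) the label $(\min A,\min B)^u$ in $\Lambda_n^w=\Gamma_1\oplus\cdots\oplus\Gamma_{n-1}$ (ordinal sum), where $\Gamma_a=\{(a,b)^u:a<b\le n,u\in\{0,1\}\}$ with $(a,b)^u\le(a,c)^v$ iff $b\le c$ and $u\le v$. $R_\lambda(P)$: for a word $w$ over a poset of labels, $\mathrm{sort}(w)$ is obtained by repeatedly taking the smallest index $i$ with $w_i<w_{i+1}$ and swapping $w_i,w_{i+1}$ until none exists. For $P$ with edge labeling $\lambda$, $R_\lambda(P)$ is the set of pairs $(x,w)$ with $x\in P$ and $w$ the label sequence of an ascent-free saturated chain from $\hat0$ to $x$ (no consecutive labels with $\ell_i<\ell_{i+1}$), with $(x,w)\lessdot(y,u)$ iff $x\lessdot y$ and $u=\mathrm{sort}(w\,\lambda(x\lessdot y))$. Trees: a bicolored binary forest on $[n]$ is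 a forest of rooted planar binary trees (left child $L(v)$, right child $R(v)$) with leaves bijectively labeled by $[n]$ and internal vertices colored in $\{0,1\}$. $\nu(v)$ is the smallest leaf label below $v$; normalized means $\nu(v)=\nu(L(v))$ for all internal $v$; $v$ is Lyndon if $L(v)$ is a leaf or $\nu(R(L(v)))>\nu(R(v))$. A normalized bicolored binary tree is a bicolored Lyndon tree if every internal $v$ whose left child is internal is Lyndon or satisfies $\mathrm{color}(L(v))>\mathrm{color}(v)$; a bicolored Lyndon forest has all components bicolored Lyndon trees. To $u$-merge two bicolored Lyndon trees $T_1,T_2$ (min leaf of $T_1$ smaller), create a new vertex $r$ of color $u$ with left child the root of $T_1$ and right child the root of $T_2$; while the result is not a bicolored Lyndon tree, slide $r$ past its left child, replacing the subtree $r(x(X_L,X_R),Y)$ by $x(r(X_L,Y),X_R)$ (colors kept). $\mathcal{FL}yn_n^w$ is the set of bicolored Lyndon forests on $[n]$ with $F\lessdot F'$ iff $F'$ is obtained by $u$-merging exactly two trees of $F$ for some $u\in\{0,1\}$. Whitney numbers: $w_k(P)=\sum_{\rho(x)=k}\mu(\hat0,x)$, $W_k(P)=\#\{x:\rho(x)=k\}$; $P,Q$ are Whitney duals if $|w_k(P)|=W_k(Q)$ and $|w_k(Q)|=W_k(P)$ for all $k$. *)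

theory Defs
  imports Main "HOL-Library.Disjoint_Sets" "HOL-Library.While_Combinator"
begin

section \<open>Posets, Whitney numbers and Whitney duality\<close>

text \<open>
  A poset is represented by its order relation \<open>r :: 'a rel\<close>, pairs \<open>(x, y)\<close> meaning
  \<open>x \<le> y\<close>.  As \<open>r\<close> is reflexive on its underlying set, that set is \<open>Field r\<close>.
\<close>

definition generated_order :: "'a set \<Rightarrow> ('a \<Rightarrow> 'a \<Rightarrow> bool) \<Rightarrow> 'a rel" where
  "generated_order C step =
     {(x, y). x \<in> C \<and> y \<in> C \<and> (x, y) \<in> {(a, b). a \<in> C \<and> b \<in> C \<and> step a b}\<^sup>*}"

definition less_in :: "'a rel \<Rightarrow> 'a \<Rightarrow> 'a \<Rightarrow> bool" where
  "less_in r x y \<longleftrightarrow> (x, y) \<in> r \<and> x \<noteq> y"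

definition covered_by :: "'a rel \<Rightarrow> 'a \<Rightarrow> 'a \<Rightarrow> bool" where
  "covered_by r x y \<longleftrightarrow> less_in r x y \<and> \<not> (\<exists>z. less_in r x z \<and> less_in r z y)"

definition is_minimum :: "'a rel \<Rightarrow> 'a \<Rightarrow> bool" where
  "is_minimum r b \<longleftrightarrow> b \<in> Field r \<and> (\<forall>x \<in> Field r. (b, x) \<in> r)"

definition zero_hat :: "'a rel \<Rightarrow> 'a" where
  "zero_hat r = (THE b. is_minimum r b)"

definition saturated_chain :: "'a rel \<Rightarrow> 'a \<Rightarrow> 'a \<Rightarrow> 'a list \<Rightarrow> bool" where
  "saturated_chain r x y xs \<longleftrightarrow>
     xs \<noteq> [] \<and> set xs \<subseteq> Field r \<and> hd xs = x \<and> last xs = y \<and> successively (covered_by r) xs"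

definition graded_poset :: "'a rel \<Rightarrow> bool" where
  "graded_poset r \<longleftrightarrow>
     finite (Field r) \<and> partial_order_on (Field r) r \<and> (\<exists>b. is_minimum r b) \<and>
     (\<forall>x xs ys. saturated_chain r (zero_hat r) x xs \<and> saturated_chain r (zero_hat r) x ys
        \<longrightarrow> length xs = length ys)"

text \<open>A chain with \<open>k + 1\<close> elements has length \<open>k\<close>.\<close>

definition rank :: "'a rel \<Rightarrow> 'a \<Rightarrow> nat" where
  "rank r x = (THE k. \<exists>xs. saturated_chain r (zero_hat r) x xs \<and> length xs = Suc k)"

text \<open>
  The Moebius function, by its usual recursion
  \<open>\<mu>(x,x) = 1\<close> and \<open>\<mu>(x,y) = - (\<Sum>x \<le> z < y. \<mu>(x,z))\<close>.
  The guard on \<open>r\<close> only serves to make the recursion terminate.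
\<close>

function mobius :: "'a rel \<Rightarrow> 'a \<Rightarrow> 'a \<Rightarrow> int" where
  "mobius r x y =
     (if finite (Field r) \<and> partial_order_on (Field r) r \<and> (x, y) \<in> r
      then (if x = y then 1
            else - (\<Sum>z \<in> {z. (x, z) \<in> r \<and> less_in r z y}. mobius r x z))
      else 0)"
  by pat_completeness auto
termination
proof (relation "Wellfounded.measure (\<lambda>(r, x, y). card {z. (z, y) \<in> r})", goal_cases)
  case 1
  show ?case by simp
next
  case (2 r x y z)
  then have fin: "finite (Field r)" and po: "partial_order_on (Field r) r"
    and zy: "(z, y) \<in> r" "z \<noteq> y"
    by (auto simp: less_in_def)
  have tr: "trans r" and an: "antisym r" and re: "refl_on (Field r) r"
    using po by (auto simp: partial_order_on_def preorder_on_def)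
  have yF: "y \<in> Field r" using zy by (auto intro: FieldI2)
  have sub: "{w. (w, z) \<in> r} \<subseteq> {w. (w, y) \<in> r}"
    using zy tr by (auto dest: transD)
  have "y \<in> {w. (w, y) \<in> r}" using re yF by (auto dest: refl_onD)
  moreover have "y \<notin> {w. (w, z) \<in> r}" using zy an by (auto dest: antisymD)
  ultimately have "{w. (w, z) \<in> r} \<subset> {w. (w, y) \<in> r}" using sub by blast
  moreover have "finite {w. (w, y) \<in> r}"
    by (rule finite_subset[OF _ fin]) (auto intro: FieldI1)
  ultimately show ?case by (simp add: psubset_card_mono)
qed

declare mobius.simps [simp del]

definition whitney_first :: "'a rel \<Rightarrow> nat \<Rightarrow> int" where
  "whitney_first r k = (\<Sum>x \<in> {x \<in> Field r. rank r x = k}. mobius r (zero_hat r) x)"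

definition whitney_second :: "'a rel \<Rightarrow> nat \<Rightarrow> nat" where
  "whitney_second r k = card {x \<in> Field r. rank r x = k}"

definition whitney_duals :: "'a rel \<Rightarrow> 'b rel \<Rightarrow> bool" where
  "whitney_duals P Q \<longleftrightarrow>
     graded_poset P \<and> graded_poset Q \<and>
     (\<forall>k. \<bar>whitney_first P k\<bar> = int (whitney_second Q k) \<and>
          \<bar>whitney_first Q k\<bar> = int (whitney_second P k))"

definition poset_isomorphic :: "'a rel \<Rightarrow> 'b rel \<Rightarrow> bool" where
  "poset_isomorphic P Q \<longleftrightarrow>
     (\<exists>f. bij_betw f (Field P) (Field Q) \<and>
        (\<forall>x \<in> Field P. \<forall>y \<in> Field P. (x, y) \<in> P \<longleftrightarrow> (f x, f y) \<in> Q))"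


section \<open>The poset of ascent-free chains of an edge-labelled poset\<close>

text \<open>Here \<open>L\<close> is the poset of labels; words over it are lists.\<close>

definition ascent_at :: "'l rel \<Rightarrow> 'l list \<Rightarrow> nat \<Rightarrow> bool" where
  "ascent_at L w i \<longleftrightarrow> Suc i < length w \<and> less_in L (w ! i) (w ! Suc i)"

definition ascent_free :: "'l rel \<Rightarrow> 'l list \<Rightarrow> bool" where
  "ascent_free L w \<longleftrightarrow> \<not> (\<exists>i. ascent_at L w i)"

definition swap_first_ascent :: "'l rel \<Rightarrow> 'l list \<Rightarrow> 'l list" where
  "swap_first_ascent L w =
     (let i = (LEAST i. ascent_at L w i) in w[i := w ! Suc i, Suc i := w ! i])"

definition sort_word :: "'l rel \<Rightarrow> 'l list \<Rightarrow> 'l list" where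
  "sort_word L w = while (\<lambda>v. \<not> ascent_free L v) (swap_first_ascent L) w"

definition chain_labels :: "('a \<Rightarrow> 'a \<Rightarrow> 'l) \<Rightarrow> 'a list \<Rightarrow> 'l list" where
  "chain_labels lab xs = map2 lab (butlast xs) (tl xs)"

definition R_elements :: "'l rel \<Rightarrow> ('a \<Rightarrow> 'a \<Rightarrow> 'l) \<Rightarrow> 'a rel \<Rightarrow> ('a \<times> 'l list) set" where
  "R_elements L lab P =
     {(x, w). \<exists>xs. saturated_chain P (zero_hat P) x xs \<and> w = chain_labels lab xs \<and>
                   ascent_free L w}"

definition R_step ::
  "'l rel \<Rightarrow> ('a \<Rightarrow> 'a \<Rightarrow> 'l) \<Rightarrow> 'a rel \<Rightarrow> 'a \<times> 'l list \<Rightarrow> 'a \<times> 'l list \<Rightarrow> bool" where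
  "R_step L lab P = (\<lambda>(x, w) (y, u). covered_by P x y \<and> u = sort_word L (w @ [lab x y]))"

definition R_poset :: "'l rel \<Rightarrow> ('a \<Rightarrow> 'a \<Rightarrow> 'l) \<Rightarrow> 'a rel \<Rightarrow> ('a \<times> 'l list) rel" where
  "R_poset L lab P = generated_order (R_elements L lab P) (R_step L lab P)"


section \<open>Weighted partitions\<close>

text \<open>
  The values \<open>u \<in> {0, 1}\<close> are represented by \<^typ>\<open>bool\<close>, with its order
  \<^prop>\<open>False < True\<close>, and converted to numbers by \<^const>\<open>of_bool\<close>.
\<close>

type_synonym bit = bool
type_synonym weighted_set = "nat set \<times> nat"
type_synonym label = "nat \<times> nat \<times> bit"

definition is_weighted_set :: "weighted_set \<Rightarrow> bool" where
  "is_weighted_set = (\<lambda>(A, v). finite A \<and> A \<noteq> {} \<and> v \<in> {0..card A - 1})"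

text \<open>Injectivity of \<^const>\<open>fst\<close> says that a block carries only one weight.\<close>

definition weighted_partitions :: "nat \<Rightarrow> weighted_set set set" where
  "weighted_partitions n =
     {\<pi>. (\<forall>X \<in> \<pi>. is_weighted_set X) \<and> inj_on fst \<pi> \<and> partition_on {1..n} (fst ` \<pi>)}"

definition merge_blocks ::
  "nat set \<Rightarrow> nat \<Rightarrow> nat set \<Rightarrow> nat \<Rightarrow> bit \<Rightarrow> weighted_set set \<Rightarrow> weighted_set set" where
  "merge_blocks A a B b u \<pi> = insert (A \<union> B, a + b + of_bool u) (\<pi> - {(A, a), (B, b)})"

definition wp_step :: "weighted_set set \<Rightarrow> weighted_set set \<Rightarrow> bool" where
  "wp_step \<pi> \<pi>' \<longleftrightarrow>
     (\<exists>A a B b u. (A, a) \<in> \<pi> \<and> (B, b) \<in> \<pi> \<and> A \<noteq> B \<and> \<pi>' = merge_blocks A a B b u \<pi>)"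

definition Pi_w :: "nat \<Rightarrow> weighted_set set rel" where
  "Pi_w n = generated_order (weighted_partitions n) wp_step"

definition lambda_w :: "weighted_set set \<Rightarrow> weighted_set set \<Rightarrow> label" where
  "lambda_w \<pi> \<pi>' =
     (THE l. \<exists>A a B b u. (A, a) \<in> \<pi> \<and> (B, b) \<in> \<pi> \<and> Min A < Min B \<and>
        \<pi>' = merge_blocks A a B b u \<pi> \<and> l = (Min A, Min B, u))"

definition Gamma_w :: "nat \<Rightarrow> nat \<Rightarrow> label rel" where
  "Gamma_w n a =
     {((a, b, u), (a, c, v)) | b c u v.
        a < b \<and> b \<le> n \<and> a < c \<and> c \<le> n \<and> b \<le> c \<and> u \<le> v}"

definition ordinal_sum :: "nat set \<Rightarrow> (nat \<Rightarrow> 'l rel) \<Rightarrow> 'l rel" where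
  "ordinal_sum I G =
     (\<Union>a \<in> I. G a) \<union> (\<Union>a \<in> I. \<Union>a' \<in> {a' \<in> I. a < a'}. Field (G a) \<times> Field (G a'))"

definition Lambda_w :: "nat \<Rightarrow> label rel" where
  "Lambda_w n = ordinal_sum {1..n - 1} (Gamma_w n)"


section \<open>Bicolored Lyndon forests\<close>

datatype btree = Leaf nat | Node (color: bit) (left: btree) (right: btree)

fun leaf_list :: "btree \<Rightarrow> nat list" where
  "leaf_list (Leaf i) = [i]"
| "leaf_list (Node c l r) = leaf_list l @ leaf_list r"

definition leaf_set :: "btree \<Rightarrow> nat set" where
  "leaf_set t = set (leaf_list t)"

text \<open>A vertex is identified with the subtree rooted at it.\<close>

fun subtrees :: "btree \<Rightarrow> btree set" where
  "subtrees (Leaf i) = {Leaf i}"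
| "subtrees (Node c l r) = insert (Node c l r) (subtrees l \<union> subtrees r)"

definition is_internal :: "btree \<Rightarrow> bool" where
  "is_internal t \<longleftrightarrow> (\<exists>c l r. t = Node c l r)"

definition nu :: "btree \<Rightarrow> nat" where
  "nu t = Min (leaf_set t)"

definition normalized :: "btree \<Rightarrow> bool" where
  "normalized t \<longleftrightarrow> (\<forall>v \<in> subtrees t. is_internal v \<longrightarrow> nu v = nu (left v))"

text \<open>Only meaningful for internal \<open>v\<close>.\<close>

definition lyndon_vertex :: "btree \<Rightarrow> bool" where
  "lyndon_vertex v \<longleftrightarrow> \<not> is_internal (left v) \<or> nu (right (left v)) > nu (right v)"

definition bicolored_lyndon_tree :: "btree \<Rightarrow> bool" where
  "bicolored_lyndon_tree t \<longleftrightarrow>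
     normalized t \<and>
     (\<forall>v \<in> subtrees t. is_internal v \<and> is_internal (left v) \<longrightarrow>
        lyndon_vertex v \<or> color (left v) > color v)"

text \<open>Forests are unordered, hence sets of trees.\<close>

definition bicolored_lyndon_forests :: "nat \<Rightarrow> btree set set" where
  "bicolored_lyndon_forests n =
     {F. (\<forall>t \<in> F. distinct (leaf_list t) \<and> bicolored_lyndon_tree t) \<and>
         pairwise (\<lambda>s t. disjnt (leaf_set s) (leaf_set t)) F \<and>
         (\<Union>t \<in> F. leaf_set t) = {1..n}}"

text \<open>
  \<open>slide k t\<close> slides the vertex reached from the root of \<open>t\<close> by going \<open>k\<close> times to the left
  past its left child.  After \<open>k\<close> slides the new vertex of a merge is at depth \<open>k\<close> on the
  leftmost branch.
\<close>

fun slide :: "nat \<Rightarrow> btree \<Rightarrow> btree" where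
  "slide 0 (Node u (Node c xl xr) y) = Node c (Node u xl y) xr"
| "slide (Suc k) (Node c l r) = Node c (slide k l) r"
| "slide _ t = t"

definition merge_trees :: "bit \<Rightarrow> btree \<Rightarrow> btree \<Rightarrow> btree" where
  "merge_trees u t1 t2 =
     snd (while (\<lambda>(k, t). \<not> bicolored_lyndon_tree t) (\<lambda>(k, t). (Suc k, slide k t))
            (0, Node u t1 t2))"

definition forest_step :: "btree set \<Rightarrow> btree set \<Rightarrow> bool" where
  "forest_step F F' \<longleftrightarrow>
     (\<exists>t1 t2 u. t1 \<in> F \<and> t2 \<in> F \<and> nu t1 < nu t2 \<and>
        F' = insert (merge_trees u t1 t2) (F - {t1, t2}))"

definition FLyn_w :: "nat \<Rightarrow> btree set rel" where
  "FLyn_w n = generated_order (bicolored_lyndon_forests n) forest_step"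

end

theory Submission
  imports Defs "HOL-Library.Multiset"
begin

text \<open>
  Both posets consist of systems of disjoint blocks covering \<open>{1..n}\<close>, with a cover merging the
  blocks with minima \<open>a < b\<close> and recorded by the label \<open>(a, b)\<^sup>u\<close>; a word of labels can be
  executed from the bottom element of one poset iff it can be executed from the other. In
  \<open>\<Pi>\<^sub>n\<^sup>w\<close> every interval has a unique ascending chain, in the forest poset every interval has a
  unique ascent-free chain. An alternating sum over the splittings of a chain into an ascent-free
  and an ascending part (or vice versa) then expresses \<open>\<bar>\<mu>(0, x)\<bar>\<close> in the first poset as
  the number of ascent-free chains below \<open>x\<close>, and in the second as the number of ascending ones,
  which yields the duality. Swapping an ascent changes neither the partition nor the forest a word
  leads to, so sorting picks the ascent-free word of the same forest; mapping a forest to its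
  ascent-free word is the isomorphism.
\<close>

section \<open>Posets presented by labelled covering steps\<close>

text \<open>Executability depends only on the set of block minima: a merge of the blocks with minima
  a < b keeps a and deletes b, whatever the blocks carry. So the posets differ only in which words
  end at the same element. Existence of the distinguished word in an interval is local: a forbidden
  pair of neighbouring labels is rewritten, and a lexicographic order decreases. Uniqueness is the
  obstacle and needs a different invariant in each poset. A final partition reveals all pairs (a, b)
  of an ascending word, but its bits only through sums in the weights; this suffices because the
  bits belonging to one a increase along an ascending word. A forest stores every label at a vertex,
  but hides the order of commuting merges; the mutual order of incomparable labels survives in the
  preorder of the tree, and determines an ascent-free word. The relations used for the two posets
  are complementary, so the words counted by the Moebius function of one are the distinguished words
  of the other.\<close>

lemma lex_replace: "(m, l) \<in> R \<Longrightarrow> (p @ [m, m'] @ q, p @ [l, l'] @ q) \<in> lex R"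
  by (auto simp: lex_conv)

text \<open>A finite deterministic automaton whose reachability order is the poset.
  \<open>pred\<close> makes \<open>zero\<close> the minimum, \<open>rk_act\<close> makes the order
  antisymmetric and graded, and the bound \<open>N\<close> with finitely many labels leaves finitely
  many paths.\<close>

locale labelled_steps =
  fixes C :: "'s set" and en :: "'s \<Rightarrow> 'l set" and act :: "'s \<Rightarrow> 'l \<Rightarrow> 's"
    and zero :: 's and rk :: "'s \<Rightarrow> nat" and labels :: "'l set" and N :: nat
  assumes zero_in: "zero \<in> C"
    and act_in: "x \<in> C \<Longrightarrow> l \<in> en x \<Longrightarrow> act x l \<in> C"
    and rk_act: "x \<in> C \<Longrightarrow> l \<in> en x \<Longrightarrow> rk (act x l) = Suc (rk x)"
    and rk_zero: "rk zero = 0"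
    and rk_le: "x \<in> C \<Longrightarrow> rk x \<le> N"
    and en_subset: "x \<in> C \<Longrightarrow> en x \<subseteq> labels"
    and finite_labels: "finite labels"
    and inj_act: "x \<in> C \<Longrightarrow> inj_on (act x) (en x)"
    and pred: "x \<in> C \<Longrightarrow> x \<noteq> zero \<Longrightarrow> \<exists>y\<in>C. \<exists>l\<in>en y. x = act y l"
begin

definition step :: "'s \<Rightarrow> 's \<Rightarrow> bool" where
  "step x y \<longleftrightarrow> (\<exists>l\<in>en x. y = act x l)"

abbreviation ord :: "'s rel" where
  "ord \<equiv> generated_order C step"

fun path :: "'s \<Rightarrow> 'l list \<Rightarrow> bool" where
  "path x [] \<longleftrightarrow> True"
| "path x (l # w) \<longleftrightarrow> l \<in> en x \<and> path (act x l) w"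

abbreviation exec :: "'s \<Rightarrow> 'l list \<Rightarrow> 's" where
  "exec \<equiv> foldl act"

fun states :: "'s \<Rightarrow> 'l list \<Rightarrow> 's list" where
  "states x [] = [x]"
| "states x (l # w) = x # states (act x l) w"

lemma path_append: "path x (v @ w) \<longleftrightarrow> path x v \<and> path (exec x v) w"
  by (induction v arbitrary: x) auto

lemma exec_in: "x \<in> C \<Longrightarrow> path x w \<Longrightarrow> exec x w \<in> C"
  by (induction w arbitrary: x) (auto simp: act_in)

lemma rk_exec: "x \<in> C \<Longrightarrow> path x w \<Longrightarrow> rk (exec x w) = rk x + length w"
  by (induction w arbitrary: x) (auto simp: act_in rk_act)

lemma path_labels: "x \<in> C \<Longrightarrow> path x w \<Longrightarrow> set w \<subseteq> labels"
proof (induction w arbitrary: x)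
  case (Cons l w)
  then show ?case using en_subset[of x] act_in[of x l] by auto
qed simp

lemma path_length: "x \<in> C \<Longrightarrow> path x w \<Longrightarrow> length w \<le> N"
  using rk_exec[of x w] rk_le[OF exec_in[of x w]] by simp

lemma finite_paths: "x \<in> C \<Longrightarrow> finite {w. path x w}"
  by (rule finite_subset[OF _ finite_lists_length_le[OF finite_labels, of N]])
    (auto dest: path_labels path_length)

lemma ord_iff: "(x, y) \<in> ord \<longleftrightarrow> x \<in> C \<and> (\<exists>w. path x w \<and> exec x w = y)"
proof
  assume "(x, y) \<in> ord"
  then have "x \<in> C" and rt: "(x, y) \<in> {(a, b). a \<in> C \<and> b \<in> C \<and> step a b}\<^sup>*"
    by (auto simp: generated_order_def)
  from rt have "\<exists>w. path x w \<and> exec x w = y"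
  proof (induction rule: rtrancl_induct)
    case base
    show ?case by (rule exI[of _ "[]"]) simp
  next
    case (step y z)
    then obtain w l where "path x w" "exec x w = y" "l \<in> en y" "z = act y l"
      by (auto simp: step_def)
    then show ?case by (intro exI[of _ "w @ [l]"]) (simp add: path_append)
  qed
  with \<open>x \<in> C\<close> show "x \<in> C \<and> (\<exists>w. path x w \<and> exec x w = y)" by simp
next
  assume "x \<in> C \<and> (\<exists>w. path x w \<and> exec x w = y)"
  then obtain w where "x \<in> C" "path x w" "exec x w = y" by auto
  then have "(x, y) \<in> {(a, b). a \<in> C \<and> b \<in> C \<and> step a b}\<^sup>*"
  proof (induction w arbitrary: x)
    case (Cons l w)
    then have "(x, act x l) \<in> {(a, b). a \<in> C \<and> b \<in> C \<and> step a b}"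
      by (auto simp: step_def act_in)
    moreover have "(act x l, y) \<in> {(a, b). a \<in> C \<and> b \<in> C \<and> step a b}\<^sup>*"
      using Cons by (auto simp: act_in)
    ultimately show ?case by (rule converse_rtrancl_into_rtrancl)
  qed simp
  then show "(x, y) \<in> ord"
    using exec_in[OF \<open>x \<in> C\<close> \<open>path x w\<close>] \<open>x \<in> C\<close> \<open>exec x w = y\<close>
    by (simp add: generated_order_def)
qed

lemma ord_in: "(x, y) \<in> ord \<Longrightarrow> x \<in> C \<and> y \<in> C"
  by (auto simp: generated_order_def)

lemma ord_refl: "x \<in> C \<Longrightarrow> (x, x) \<in> ord"
  by (auto simp: generated_order_def)

lemma Field_ord: "Field ord = C"
  using ord_refl ord_in by (fastforce simp: Field_def)

lemma rk_mono: "(x, y) \<in> ord \<Longrightarrow> rk x \<le> rk y"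
  by (auto simp: ord_iff rk_exec)

lemma rk_strict_mono: "less_in ord x y \<Longrightarrow> rk x < rk y"
proof -
  assume "less_in ord x y"
  then obtain w where "x \<in> C" "path x w" "exec x w = y" "x \<noteq> y"
    by (auto simp: less_in_def ord_iff)
  moreover from this have "w \<noteq> []" by auto
  ultimately show ?thesis using rk_exec[of x w] by auto
qed

lemma partial_order_ord: "partial_order_on (Field ord) ord"
proof -
  have "refl_on (Field ord) ord"
    using ord_refl ord_in by (auto simp: Field_ord refl_on_def)
  moreover have "trans ord"
    unfolding generated_order_def trans_def by auto
  moreover have "antisym ord"
  proof (rule antisymI, rule ccontr)
    fix x y assume "(x, y) \<in> ord" "(y, x) \<in> ord" "x \<noteq> y"
    then show False
      using rk_strict_mono[of x y] rk_mono[of y x] by (simp add: less_in_def)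
  qed
  moreover have "ord \<subseteq> Field ord \<times> Field ord"
    by (auto simp: Field_def)
  ultimately show ?thesis
    by (simp add: partial_order_on_def preorder_on_def)
qed

lemma reachable: "x \<in> C \<Longrightarrow> \<exists>w. path zero w \<and> exec zero w = x"
proof (induction "rk x" arbitrary: x rule: less_induct)
  case less
  show ?case
  proof (cases "x = zero")
    case True
    then show ?thesis by (intro exI[of _ "[]"]) simp
  next
    case False
    then obtain y l where y: "y \<in> C" "l \<in> en y" "x = act y l" using pred less.prems by blast
    then obtain w where "path zero w" "exec zero w = y" using less.hyps rk_act by force
    then show ?thesis using y by (intro exI[of _ "w @ [l]"]) (simp add: path_append)
  qed
qed

lemma finite_C: "finite C"
proof (rule finite_surj[OF finite_paths[OF zero_in]])
  show "C \<subseteq> exec zero ` {w. path zero w}" using reachable by blast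
qed

lemma is_minimum_iff: "is_minimum ord b \<longleftrightarrow> b = zero"
proof -
  have z: "(zero, x) \<in> ord" if "x \<in> C" for x
    using reachable[OF that] zero_in by (auto simp: ord_iff)
  moreover have "b = zero" if "b \<in> C" "(b, zero) \<in> ord"
    using z[OF that(1)] that partial_order_ord by (auto simp: partial_order_on_def dest: antisymD)
  ultimately show ?thesis using zero_in by (auto simp: is_minimum_def Field_ord)
qed

lemma zero_hat_ord: "zero_hat ord = zero"
  by (simp add: zero_hat_def is_minimum_iff)

text \<open>A step raises the rank by exactly one, so nothing fits in between; conversely, the first
  state on a path to a covering element must already be that element.\<close>

lemma covered_by_iff: "covered_by ord x y \<longleftrightarrow> x \<in> C \<and> step x y"
proof
  assume cov: "covered_by ord x y"
  then obtain w where w: "x \<in> C" "path x w" "exec x w = y" "x \<noteq> y"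
    by (auto simp: covered_by_def less_in_def ord_iff)
  then obtain l v where [simp]: "w = l # v" by (cases w) auto
  have l: "l \<in> en x" "path (act x l) v" "exec (act x l) v = y" using w by auto
  have "(x, act x l) \<in> ord" using w l by (auto simp: ord_iff intro!: exI[of _ "[l]"])
  then have "less_in ord x (act x l)"
    using rk_act[of x l] w(1) l by (auto simp: less_in_def)
  moreover have "(act x l, y) \<in> ord" using w l by (auto simp: ord_iff act_in)
  ultimately have "act x l = y" using cov by (auto simp: covered_by_def less_in_def)
  then show "x \<in> C \<and> step x y" using w l by (auto simp: step_def)
next
  assume "x \<in> C \<and> step x y"
  then obtain l where l: "x \<in> C" "l \<in> en x" "y = act x l" by (auto simp: step_def)
  have "(x, y) \<in> ord" using l by (auto simp: ord_iff intro!: exI[of _ "[l]"])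
  moreover have r: "rk y = Suc (rk x)" using l rk_act by simp
  moreover have False if "less_in ord x z" "less_in ord z y" for z
    using rk_strict_mono[OF that(1)] rk_strict_mono[OF that(2)] r by simp
  ultimately show "covered_by ord x y" by (auto simp: covered_by_def less_in_def)
qed

lemma length_states: "length (states x w) = Suc (length w)"
  by (induction w arbitrary: x) auto

lemma states_neq_Nil: "states x w \<noteq> []"
  by (cases w) auto

lemma hd_states: "hd (states x w) = x"
  by (cases w) auto

lemma saturated_chain_iff:
  "saturated_chain ord x y xs \<longleftrightarrow> x \<in> C \<and> (\<exists>w. path x w \<and> exec x w = y \<and> xs = states x w)"
proof (induction xs arbitrary: x)
  case Nil
  then show ?case using states_neq_Nil[symmetric] by (auto simp: saturated_chain_def)
next
  case (Cons z zs)
  show ?case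
  proof (cases "zs = []")
    case True
    have "[z] = states x w \<longleftrightarrow> w = [] \<and> z = x" for w
      by (cases w) (auto simp: states_neq_Nil[symmetric])
    then show ?thesis
      using True by (auto simp: saturated_chain_def Field_ord)
  next
    case False
    have "saturated_chain ord x y (z # zs) \<longleftrightarrow>
        z = x \<and> x \<in> C \<and> step x (hd zs) \<and> saturated_chain ord (hd zs) y zs"
      using False by (cases zs) (auto simp: saturated_chain_def covered_by_iff Field_ord)
    also have "\<dots> \<longleftrightarrow> z = x \<and> x \<in> C \<and> step x (hd zs) \<and>
        (\<exists>w. path (hd zs) w \<and> exec (hd zs) w = y \<and> zs = states (hd zs) w)"
      unfolding Cons.IH by (auto simp: step_def act_in)
    also have "\<dots> \<longleftrightarrow> x \<in> C \<and> (\<exists>w. path x w \<and> exec x w = y \<and> z # zs = states x w)"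
    proof safe
      fix w assume "x \<in> C" "step x (hd zs)" "path (hd zs) w" "y = exec (hd zs) w"
        "zs = states (hd zs) w"
      moreover from this obtain l where "l \<in> en x" "hd zs = act x l" by (auto simp: step_def)
      ultimately show "\<exists>wa. path x wa \<and> exec x wa = exec (hd zs) w \<and> x # zs = states x wa"
        by (intro exI[of _ "l # w"]) auto
    next
      fix w assume w: "x \<in> C" "path x w" "z # zs = states x w"
      then obtain l v where "w = l # v" using False by (cases w) auto
      with w show "z = x" "step x (hd zs)"
        "\<exists>wa. path (hd zs) wa \<and> exec (hd zs) wa = exec x w \<and> zs = states (hd zs) wa"
        by (auto simp: step_def hd_states)
    qed
    finally show ?thesis .
  qed
qed

lemma graded: "graded_poset ord"
  unfolding graded_poset_def zero_hat_ord saturated_chain_iff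
proof (intro conjI allI impI)
  show "finite (Field ord)" by (simp add: Field_ord finite_C)
  show "\<exists>b. is_minimum ord b" by (simp add: is_minimum_iff)
  fix x xs ys
  assume "(zero \<in> C \<and> (\<exists>w. path zero w \<and> exec zero w = x \<and> xs = states zero w)) \<and>
     (zero \<in> C \<and> (\<exists>w. path zero w \<and> exec zero w = x \<and> ys = states zero w))"
  then obtain v w where "path zero v" "exec zero v = x" "xs = states zero v"
    "path zero w" "exec zero w = x" "ys = states zero w"
    by blast
  then show "length xs = length ys"
    using rk_exec[OF zero_in, of v] rk_exec[OF zero_in, of w] by (simp add: length_states)
qed (rule partial_order_ord)

lemma rank_ord: "x \<in> C \<Longrightarrow> rank ord x = rk x"
  unfolding rank_def zero_hat_ord saturated_chain_iff
proof (rule the_equality)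
  assume "x \<in> C"
  then obtain w where w: "path zero w" "exec zero w = x" using reachable by blast
  then show "\<exists>xs. (zero \<in> C \<and> (\<exists>w. path zero w \<and> exec zero w = x \<and> xs = states zero w)) \<and>
      length xs = Suc (rk x)"
    using rk_exec[OF zero_in w(1)] zero_in by (auto simp: length_states rk_zero)
next
  fix k
  assume "\<exists>xs. (zero \<in> C \<and> (\<exists>w. path zero w \<and> exec zero w = x \<and> xs = states zero w)) \<and>
      length xs = Suc k"
  then show "k = rk x" by (auto simp: length_states rk_exec rk_zero)
qed

lemma chain_labels_states:
  assumes "\<And>x l. x \<in> C \<Longrightarrow> l \<in> en x \<Longrightarrow> lab x (act x l) = l"
  shows "x \<in> C \<Longrightarrow> path x w \<Longrightarrow> chain_labels lab (states x w) = w"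
proof (induction w arbitrary: x)
  case (Cons l w)
  then have "chain_labels lab (states (act x l) w) = w" by (auto simp: act_in)
  moreover obtain zs where "states (act x l) w = act x l # zs"
    using hd_states[of "act x l" w] states_neq_Nil[of "act x l" w]
    by (cases "states (act x l) w") auto
  ultimately show ?case using Cons.prems assms by (simp add: chain_labels_def)
qed (simp add: chain_labels_def)

text \<open>A rewriting argument: a pair violating \<open>A\<close> is replaced by another pair with
  the same endpoint and a smaller first letter. The second letter may grow, since \<open>lex\<close>
  compares words of equal length at the first difference.\<close>

lemma exists_successively:
  assumes "wf R"
    and swap: "\<And>x l l'. x \<in> C \<Longrightarrow> l \<in> en x \<Longrightarrow> l' \<in> en (act x l) \<Longrightarrow> \<not> A l l' \<Longrightarrow>
      \<exists>m m'. m \<in> en x \<and> m' \<in> en (act x m) \<and> act (act x m) m' = act (act x l) l' \<and> (m, l) \<in> R"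
  shows "x \<in> C \<Longrightarrow> path x w \<Longrightarrow> \<exists>v. path x v \<and> exec x v = exec x w \<and> successively A v"
proof (induction w rule: wf_induct_rule[OF wf_lex[OF \<open>wf R\<close>]])
  case (1 w)
  show ?case
  proof (cases "successively A w")
    case False
    then obtain i where i: "Suc i < length w" "\<not> A (w ! i) (w ! Suc i)"
      by (auto simp: successively_conv_nth)
    define p q l l' where pq: "p = take i w" "q = drop (Suc (Suc i)) w" "l = w ! i" "l' = w ! Suc i"
    have w: "w = p @ [l, l'] @ q"
      using i unfolding pq
      by (metis Cons_nth_drop_Suc Suc_lessD append_Cons append_Nil append_take_drop_id)
    let ?y = "exec x p"
    have y: "?y \<in> C" "l \<in> en ?y" "l' \<in> en (act ?y l)" "path (act (act ?y l) l') q"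
      using 1(2,3) exec_in[of x p] by (auto simp: w path_append)
    obtain m m' where m: "m \<in> en ?y" "m' \<in> en (act ?y m)"
      "act (act ?y m) m' = act (act ?y l) l'" "(m, l) \<in> R"
      using swap[OF y(1,2,3)] i pq by auto
    let ?v = "p @ [m, m'] @ q"
    have "path x ?v" "exec x ?v = exec x w"
      using 1(3) m y by (auto simp: w path_append)
    moreover have "(?v, w) \<in> lex R"
      unfolding w by (rule lex_replace[OF m(4)])
    ultimately show ?thesis using 1(1)[of ?v] 1(2) by auto
  qed (use 1 in blast)
qed

end

section \<open>Splittings of a word and a sign-reversing involution\<close>

lemma successively_append_singleton:
  "successively P (xs @ [x]) \<longleftrightarrow> successively P xs \<and> (xs = [] \<or> P (last xs) x)"
  by (auto simp: successively_append_iff)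

definition splitting :: "('l \<Rightarrow> 'l \<Rightarrow> bool) \<Rightarrow> 'l list \<times> 'l list \<Rightarrow> bool" where
  "splitting A = (\<lambda>(v, w). successively (\<lambda>l l'. \<not> A l l') v \<and> successively A w)"

text \<open>The letter at the boundary changes sides: the head of \<open>w\<close> moves left if
  this creates no \<open>A\<close>-step in the left part, and otherwise the last letter of
  \<open>v\<close> moves right. In the second case the boundary is an \<open>A\<close>-step or
  \<open>w\<close> is empty, so the right part stays \<open>A\<close>-ascending.\<close>

definition toggle :: "('l \<Rightarrow> 'l \<Rightarrow> bool) \<Rightarrow> 'l list \<times> 'l list \<Rightarrow> 'l list \<times> 'l list" where
  "toggle A = (\<lambda>(v, w).
     if w \<noteq> [] \<and> (v = [] \<or> \<not> A (last v) (hd w)) then (v @ [hd w], tl w)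
     else (butlast v, last v # w))"

lemma toggle:
  assumes "splitting A p" "fst p @ snd p \<noteq> []"
  shows "splitting A (toggle A p)" "fst (toggle A p) @ snd (toggle A p) = fst p @ snd p"
    "toggle A (toggle A p) = p"
    "(- 1 :: int) ^ length (fst (toggle A p)) = - ((- 1) ^ length (fst p))"
proof -
  obtain v w where p: "p = (v, w)" by (cases p)
  consider (advance) l w' where "w = l # w'" "v = [] \<or> \<not> A (last v) l"
    | (retreat) l v' where "v = v' @ [l]" "w = [] \<or> A l (hd w)"
    using assms(2) p by (cases w; cases v rule: rev_cases) auto
  then have "splitting A (toggle A p) \<and> fst (toggle A p) @ snd (toggle A p) = fst p @ snd p \<and>
    toggle A (toggle A p) = p \<and>
    (- 1 :: int) ^ length (fst (toggle A p)) = - ((- 1) ^ length (fst p))"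
  proof cases
    case advance
    then have t: "toggle A p = (v @ [l], w')" by (auto simp: p toggle_def)
    have "w' \<noteq> [] \<Longrightarrow> A l (hd w')"
      using assms(1) advance by (simp add: p splitting_def successively_Cons)
    then have "toggle A (v @ [l], w') = p" using advance by (auto simp: p toggle_def)
    moreover have "splitting A (v @ [l], w')"
      using assms(1) advance
      by (auto simp: p splitting_def successively_append_singleton successively_Cons)
    ultimately show ?thesis using t advance by (simp add: p)
  next
    case retreat
    then have t: "toggle A p = (v', l # w)" by (auto simp: p toggle_def)
    have "v' \<noteq> [] \<Longrightarrow> \<not> A (last v') l"
      using assms(1) retreat by (simp add: p splitting_def successively_append_singleton)
    then have "toggle A (v', l # w) = p" using retreat by (auto simp: p toggle_def)
    moreover have "splitting A (v', l # w)"
      using assms(1) retreat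
      by (auto simp: p splitting_def successively_append_singleton successively_Cons)
    ultimately show ?thesis using t retreat by (simp add: p)
  qed
  then show "splitting A (toggle A p)" "fst (toggle A p) @ snd (toggle A p) = fst p @ snd p"
    "toggle A (toggle A p) = p"
    "(- 1 :: int) ^ length (fst (toggle A p)) = - ((- 1) ^ length (fst p))"
    by blast+
qed

text \<open>Reindexing by the involution negates every summand, so the sum equals its own
  negative.\<close>

lemma sum_toggle:
  assumes S: "\<And>p. p \<in> S \<Longrightarrow> splitting A p \<and> fst p @ snd p \<noteq> []"
    and closed: "\<And>p. p \<in> S \<Longrightarrow> toggle A p \<in> S"
  shows "(\<Sum>p\<in>S. (- 1 :: int) ^ length (fst p)) = 0"
proof -
  have "(\<Sum>p\<in>S. (- 1 :: int) ^ length (fst p)) = (\<Sum>p\<in>S. - ((- 1) ^ length (fst p)))"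
  proof (rule sum.reindex_bij_witness[of _ "toggle A" "toggle A"])
    fix p assume "p \<in> S"
    with S have p: "splitting A p" "fst p @ snd p \<noteq> []" by blast+
    show "toggle A (toggle A p) = p" "toggle A (toggle A p) = p"
      by (rule toggle(3)[OF p])+
    show "- ((- 1 :: int) ^ length (fst (toggle A p))) = (- 1) ^ length (fst p)"
      unfolding toggle(4)[OF p] by simp
  qed (use closed in auto)
  then show ?thesis by (simp add: sum_negf)
qed

section \<open>Moebius function and Whitney numbers as counts of words\<close>

context labelled_steps
begin

definition unique_paths :: "('l \<Rightarrow> 'l \<Rightarrow> bool) \<Rightarrow> bool" where
  "unique_paths A \<longleftrightarrow> (\<forall>x\<in>C. \<forall>w. path x w \<longrightarrow>
     (\<exists>!v. path x v \<and> exec x v = exec x w \<and> successively A v))"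

text \<open>
  Splitting a path into a part without \<open>A\<close>-steps followed by a part with \<open>A\<close>-steps only is
  possible at exactly two neighbouring positions, so the alternating sum over all splittings
  vanishes; this is the defining recursion of the Moebius function.
\<close>

theorem mobius_ord:
  assumes U: "unique_paths A" and "y \<in> C"
  shows "mobius ord zero y = (- 1) ^ rk y *
    int (card {w. path zero w \<and> exec zero w = y \<and> successively (\<lambda>l l'. \<not> A l l') w})"
  using \<open>y \<in> C\<close>
proof (induction "rk y" arbitrary: y rule: less_induct)
  case less
  let ?N = "\<lambda>z. {w. path zero w \<and> exec zero w = z \<and> successively (\<lambda>l l'. \<not> A l l') w}"
  have finN: "finite (?N z)" for z
    by (rule finite_subset[OF _ finite_paths[OF zero_in]]) auto
  have zy: "(zero, y) \<in> ord" using reachable[OF less.prems] zero_in by (auto simp: ord_iff)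
  have nil: "w = []" if "path zero w" "exec zero w = zero" for w
    using rk_exec[OF zero_in that(1)] that(2) by (simp add: rk_zero)
  have rec: "mobius ord zero y = (if zero = y then 1
      else - (\<Sum>z \<in> {z. (zero, z) \<in> ord \<and> less_in ord z y}. mobius ord zero z))"
    using zy finite_C partial_order_ord by (subst mobius.simps) (simp add: Field_ord)
  show ?case
  proof (cases "y = zero")
    case True
    have "?N zero = {[]}" by (auto dest: nil)
    then show ?thesis using rec True by (simp add: rk_zero)
  next
    case False
    define Z where "Z = {z. (z, y) \<in> ord}"
    have finZ: "finite Z" by (rule finite_subset[OF _ finite_C]) (auto simp: Z_def dest: ord_in)
    have yZ: "y \<in> Z" using ord_refl less.prems by (simp add: Z_def)
    define T where "T = {p. path zero (fst p @ snd p) \<and> exec zero (fst p @ snd p) = y \<and> splitting A p}"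
    define suf where "suf z = (THE w. path z w \<and> exec z w = y \<and> successively A w)" for z
    have ex1: "\<exists>!w. path z w \<and> exec z w = y \<and> successively A w" if z: "z \<in> Z" for z
    proof -
      obtain w where "z \<in> C" "path z w" "exec z w = y" using z by (auto simp: Z_def ord_iff)
      then show ?thesis using U unfolding unique_paths_def by metis
    qed
    have suf: "path z (suf z) \<and> exec z (suf z) = y \<and> successively A (suf z)" if "z \<in> Z" for z
      unfolding suf_def by (rule theI'[OF ex1[OF that]])
    \<comment> \<open>Uniqueness enters here: the second part of a splitting is forced by the state
      between the parts, so a splitting amounts to a state \<open>z\<close> below \<open>y\<close>
      and a path to \<open>z\<close> without \<open>A\<close>-steps.\<close>
    have T_eq: "T = (\<lambda>(z, v). (v, suf z)) ` (SIGMA z:Z. ?N z)"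
    proof safe
      fix v w assume "(v, w) \<in> T"
      then have vw: "path zero v" "path (exec zero v) w" "exec (exec zero v) w = y"
        "successively (\<lambda>l l'. \<not> A l l') v" "successively A w"
        by (auto simp: T_def splitting_def path_append)
      then have "exec zero v \<in> Z" by (auto simp: Z_def ord_iff exec_in zero_in)
      moreover from this have "w = suf (exec zero v)" using ex1 suf vw by blast
      ultimately show "(v, w) \<in> (\<lambda>(z, v). (v, suf z)) ` (SIGMA z:Z. ?N z)"
        using vw by (auto intro!: image_eqI[of _ _ "(exec zero v, v)"])
    next
      fix v assume "exec zero v \<in> Z" "path zero v" "successively (\<lambda>l l'. \<not> A l l') v"
      then show "(v, suf (exec zero v)) \<in> T"
        using suf[of "exec zero v"] by (auto simp: T_def splitting_def path_append)
    qed
    have "(\<Sum>p\<in>T. (- 1 :: int) ^ length (fst p)) = 0"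
    proof (rule sum_toggle[of _ A])
      fix p assume p: "p \<in> T"
      then show *: "splitting A p \<and> fst p @ snd p \<noteq> []" using False by (auto simp: T_def)
      then show "toggle A p \<in> T" using p toggle(1,2)[of A p] by (simp add: T_def del: foldl_append)
    qed
    also have "(\<Sum>p\<in>T. (- 1 :: int) ^ length (fst p))
        = (\<Sum>(z, v) \<in> (SIGMA z:Z. ?N z). (- 1) ^ length v)"
      unfolding T_eq by (subst sum.reindex) (auto simp: inj_on_def case_prod_unfold)
    also have "\<dots> = (\<Sum>z\<in>Z. \<Sum>v\<in>?N z. (- 1) ^ length v)"
      by (rule sum.Sigma[symmetric]) (use finZ finN in auto)
    also have "\<dots> = (\<Sum>z\<in>Z. (- 1) ^ rk z * int (card (?N z)))"
    proof (rule sum.cong[OF refl])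
      fix z
      have "(\<Sum>v\<in>?N z. (- 1 :: int) ^ length v) = (\<Sum>v\<in>?N z. (- 1) ^ rk z)"
        by (rule sum.cong) (auto simp: rk_exec[OF zero_in] rk_zero)
      then show "(\<Sum>v\<in>?N z. (- 1 :: int) ^ length v) = (- 1) ^ rk z * int (card (?N z))"
        by simp
    qed
    also have "\<dots> = (- 1) ^ rk y * int (card (?N y)) + (\<Sum>z\<in>Z - {y}. (- 1) ^ rk z * int (card (?N z)))"
      by (rule sum.remove[OF finZ yZ])
    \<comment> \<open>By induction the terms below \<open>y\<close> are Moebius values, so the
      vanishing of the whole sum becomes the recursion for \<open>y\<close>.\<close>
    also have "(\<Sum>z\<in>Z - {y}. (- 1) ^ rk z * int (card (?N z)))
        = (\<Sum>z \<in> {z. (zero, z) \<in> ord \<and> less_in ord z y}. mobius ord zero z)"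
    proof (rule sum.cong)
      show "Z - {y} = {z. (zero, z) \<in> ord \<and> less_in ord z y}"
        using reachable zero_in
        by (auto simp: Z_def less_in_def) (auto simp: ord_iff)
    next
      fix z assume "z \<in> {z. (zero, z) \<in> ord \<and> less_in ord z y}"
      then have "z \<in> C" "rk z < rk y" using rk_strict_mono by (auto dest: ord_in)
      then show "(- 1) ^ rk z * int (card (?N z)) = mobius ord zero z" using less.hyps by simp
    qed
    finally show ?thesis using rec False by simp
  qed
qed

text \<open>Sending each element to its unique \<open>A\<close>-word turns a count of elements into
  a count of words. Only the executable words remain on the right, which makes different posets
  comparable.\<close>

lemma whitney_second_ord:
  assumes U: "unique_paths A"
  shows "whitney_second ord k = card {w. path zero w \<and> length w = k \<and> successively A w}"
proof -
  let ?W = "{w. path zero w \<and> length w = k \<and> successively A w}"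
  have "bij_betw (exec zero) ?W {x \<in> C. rk x = k}"
  proof (rule bij_betwI')
    fix v w assume "v \<in> ?W" "w \<in> ?W"
    then show "exec zero v = exec zero w \<longleftrightarrow> v = w"
      using U zero_in unfolding unique_paths_def by blast
  next
    fix w assume "w \<in> ?W"
    then show "exec zero w \<in> {x \<in> C. rk x = k}"
      by (auto simp: exec_in zero_in rk_exec rk_zero)
  next
    fix x assume x: "x \<in> {x \<in> C. rk x = k}"
    then obtain w where "path zero w" "exec zero w = x" using reachable by blast
    then obtain v where "path zero v" "exec zero v = x" "successively A v"
      using U zero_in unfolding unique_paths_def by blast
    then show "\<exists>w\<in>?W. x = exec zero w" using x rk_exec[OF zero_in, of v] by (auto simp: rk_zero)
  qed
  then have "card ?W = card {x \<in> C. rk x = k}" by (rule bij_betw_same_card)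
  also have "{x \<in> C. rk x = k} = {x \<in> Field ord. rank ord x = k}"
    by (auto simp: Field_ord rank_ord)
  finally show ?thesis by (simp add: whitney_second_def)
qed

lemma whitney_first_ord:
  assumes U: "unique_paths A"
  shows "whitney_first ord k = (- 1) ^ k *
    int (card {w. path zero w \<and> length w = k \<and> successively (\<lambda>l l'. \<not> A l l') w})"
proof -
  let ?N = "\<lambda>z. {w. path zero w \<and> exec zero w = z \<and> successively (\<lambda>l l'. \<not> A l l') w}"
  have finN: "finite (?N z)" for z
    by (rule finite_subset[OF _ finite_paths[OF zero_in]]) auto
  let ?K = "{x \<in> C. rk x = k}"
  have "whitney_first ord k = (\<Sum>x\<in>?K. mobius ord zero x)"
    unfolding whitney_first_def by (rule sum.cong) (auto simp: Field_ord rank_ord zero_hat_ord)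
  also have "\<dots> = (\<Sum>x\<in>?K. (- 1) ^ k * int (card (?N x)))"
    by (rule sum.cong) (auto simp: mobius_ord[OF U])
  also have "\<dots> = (- 1) ^ k * int (\<Sum>x\<in>?K. card (?N x))"
    by (simp add: sum_distrib_left)
  also have "(\<Sum>x\<in>?K. card (?N x)) = card (\<Union>x\<in>?K. ?N x)"
    by (rule card_UN_disjoint[symmetric]) (use finite_C finN in auto)
  also have "(\<Union>x\<in>?K. ?N x) = {w. path zero w \<and> length w = k \<and> successively (\<lambda>l l'. \<not> A l l') w}"
    using rk_exec[OF zero_in] exec_in[OF zero_in] by (auto simp: rk_zero)
  finally show ?thesis .
qed

end

section \<open>Systems of mergeable blocks\<close>

text \<open>The strict order of \<open>Lambda_w n\<close> without the range conditions. Distinct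
  labels are incomparable exactly if they share the first entry and the other two entries are
  ordered oppositely and strictly.\<close>

fun label_less :: "label \<Rightarrow> label \<Rightarrow> bool" where
  "label_less (a, b, u) (c, d, v) \<longleftrightarrow> a < c \<or> a = c \<and> b \<le> d \<and> u \<le> v \<and> (b, u) \<noteq> (d, v)"

text \<open>Executability stated through the minima alone: the common language of both
  posets.\<close>

fun merge_word :: "nat set \<Rightarrow> label list \<Rightarrow> bool" where
  "merge_word M [] \<longleftrightarrow> True"
| "merge_word M ((a, b, u) # w) \<longleftrightarrow> a \<in> M \<and> b \<in> M \<and> a < b \<and> merge_word (M - {b}) w"

definition separated :: "('o \<Rightarrow> bool) \<Rightarrow> ('o \<Rightarrow> nat set) \<Rightarrow> 'o \<Rightarrow> 'o \<Rightarrow> bool" where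
  "separated good supp X Y \<longleftrightarrow>
     good X \<and> good Y \<and> disjnt (supp X) (supp Y) \<and> Min (supp X) < Min (supp Y)"

text \<open>\<open>comb_commute\<close> is demanded exactly for two merges into the same block whose
  labels ascend, the one case of an ascent that is not a merge of disjoint pairs.
  \<open>comb_inject\<close> makes labels recoverable from covers, and \<open>decompose\<close>
  makes every configuration reachable.\<close>

locale merge_system =
  fixes good :: "'o \<Rightarrow> bool" and supp :: "'o \<Rightarrow> nat set" and comb :: "bit \<Rightarrow> 'o \<Rightarrow> 'o \<Rightarrow> 'o"
    and base :: "nat \<Rightarrow> 'o" and n :: nat
  assumes finite_supp: "good X \<Longrightarrow> finite (supp X)"
    and supp_nonempty: "good X \<Longrightarrow> supp X \<noteq> {}"
    and supp_comb: "separated good supp X Y \<Longrightarrow> supp (comb u X Y) = supp X \<union> supp Y"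
    and good_comb: "separated good supp X Y \<Longrightarrow> good (comb u X Y)"
    and comb_inject: "separated good supp X Y \<Longrightarrow> comb u X Y = comb v X Y \<Longrightarrow> u = v"
    and comb_commute: "separated good supp X Y \<Longrightarrow> separated good supp X Z \<Longrightarrow> separated good supp Y Z \<Longrightarrow> u \<le> v \<Longrightarrow>
      comb v (comb u X Y) Z = comb u (comb v X Z) Y"
    and good_base: "good (base i)"
    and supp_base: "supp (base i) = {i}"
    and decompose: "good X \<Longrightarrow> (\<exists>i. X = base i) \<or> (\<exists>u Y Z. separated good supp Y Z \<and> X = comb u Y Z)"
begin

abbreviation mergeable :: "'o \<Rightarrow> 'o \<Rightarrow> bool" where
  "mergeable \<equiv> separated good supp"

definition confs :: "'o set set" where
  "confs = {S. (\<forall>X\<in>S. good X) \<and> pairwise (\<lambda>X Y. disjnt (supp X) (supp Y)) S \<and>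
     (\<Union>X\<in>S. supp X) = {1..n}}"

abbreviation mn :: "'o \<Rightarrow> nat" where "mn X \<equiv> Min (supp X)"

definition blk :: "'o set \<Rightarrow> nat \<Rightarrow> 'o" where
  "blk S i = (THE X. X \<in> S \<and> i \<in> supp X)"

text \<open>Blocks change under merging; naming a block by its minimum allows it to be tracked along
  a path.\<close>

definition root :: "'o set \<Rightarrow> nat \<Rightarrow> nat" where
  "root S i = mn (blk S i)"

definition mins :: "'o set \<Rightarrow> nat set" where
  "mins S = mn ` S"

definition enabled :: "'o set \<Rightarrow> label set" where
  "enabled S = {(a, b, u). a \<in> mins S \<and> b \<in> mins S \<and> a < b}"

fun merge :: "'o set \<Rightarrow> label \<Rightarrow> 'o set" where
  "merge S (a, b, u) = insert (comb u (blk S a) (blk S b)) (S - {blk S a, blk S b})"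

declare merge.simps [simp del]

lemma mn_in: "good X \<Longrightarrow> mn X \<in> supp X"
  by (simp add: finite_supp supp_nonempty)

lemma good_in: "S \<in> confs \<Longrightarrow> X \<in> S \<Longrightarrow> good X"
  by (simp add: confs_def)

lemma disjnt_supp: "S \<in> confs \<Longrightarrow> X \<in> S \<Longrightarrow> Y \<in> S \<Longrightarrow> X \<noteq> Y \<Longrightarrow> disjnt (supp X) (supp Y)"
  by (auto simp: confs_def pairwise_def)

lemma blk_eq: "S \<in> confs \<Longrightarrow> X \<in> S \<Longrightarrow> i \<in> supp X \<Longrightarrow> blk S i = X"
  unfolding blk_def using disjnt_supp[of S X] by (intro the_equality) (auto simp: disjnt_iff)

lemma blk_in: "S \<in> confs \<Longrightarrow> i \<in> {1..n} \<Longrightarrow> blk S i \<in> S \<and> i \<in> supp (blk S i)"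
proof -
  assume S: "S \<in> confs" "i \<in> {1..n}"
  then obtain X where "X \<in> S" "i \<in> supp X" unfolding confs_def by blast
  then show ?thesis using blk_eq[OF S(1)] by auto
qed

lemma mins_subset: "S \<in> confs \<Longrightarrow> mins S \<subseteq> {1..n}"
  using mn_in by (force simp: mins_def confs_def)

lemma root_min: "S \<in> confs \<Longrightarrow> a \<in> mins S \<Longrightarrow> root S a = a"
  using blk_eq[OF _ _ mn_in] good_in by (force simp: mins_def root_def)

lemma blk_root: "S \<in> confs \<Longrightarrow> i \<in> {1..n} \<Longrightarrow> blk S (root S i) = blk S i"
  unfolding root_def by (rule blk_eq) (auto simp: blk_in mn_in good_in)

lemma blk_eq_iff:
  "S \<in> confs \<Longrightarrow> i \<in> {1..n} \<Longrightarrow> j \<in> {1..n} \<Longrightarrow> blk S i = blk S j \<longleftrightarrow> root S i = root S j"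
  by (metis blk_root root_def)

lemma blk_mn: "S \<in> confs \<Longrightarrow> X \<in> S \<Longrightarrow> blk S (mn X) = X"
  by (simp add: blk_eq good_in mn_in)

lemma enabledD:
  assumes "S \<in> confs" "(a, b, u) \<in> enabled S"
  shows "a \<in> {1..n}" "b \<in> {1..n}" "a < b" "root S a = a" "root S b = b"
    "blk S a \<in> S" "blk S b \<in> S" "blk S a \<noteq> blk S b" "mn (blk S a) = a" "mn (blk S b) = b"
    "mergeable (blk S a) (blk S b)"
proof -
  show ab: "a \<in> {1..n}" "b \<in> {1..n}" "a < b" "root S a = a" "root S b = b"
    using assms mins_subset[OF assms(1)] root_min[OF assms(1)] unfolding enabled_def by blast+
  then show m: "blk S a \<in> S" "blk S b \<in> S" "blk S a \<noteq> blk S b" "mn (blk S a) = a" "mn (blk S b) = b"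
    using blk_in[OF assms(1)] by (auto simp: root_def)
  then show "mergeable (blk S a) (blk S b)"
    using disjnt_supp[OF assms(1) m(1,2,3)] good_in[OF assms(1)] ab by (simp add: separated_def)
qed

lemma merge_in:
  assumes S: "S \<in> confs" and l: "l \<in> enabled S"
  shows "merge S l \<in> confs"
proof -
  obtain a b u where [simp]: "l = (a, b, u)" by (cases l)
  note e = enabledD[OF S l[simplified]]
  let ?A = "blk S a" and ?B = "blk S b"
  have s: "supp (comb u ?A ?B) = supp ?A \<union> supp ?B" by (rule supp_comb[OF e(11)])
  have "good X" if "X \<in> merge S l" for X
    using that good_in[OF S] good_comb[OF e(11)] by (auto simp: merge.simps)
  moreover have "pairwise (\<lambda>X Y. disjnt (supp X) (supp Y)) (merge S l)"
    using S disjnt_supp[OF S _ e(6)] disjnt_supp[OF S _ e(7)]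
    by (auto simp: merge.simps pairwise_insert s disjnt_Un1 disjnt_Un2 disjnt_sym confs_def pairwise_def)
  moreover have "(\<Union>X\<in>merge S l. supp X) = (\<Union>X\<in>S. supp X)"
    using e(6,7) by (auto simp: merge.simps s)
  ultimately show ?thesis using S by (auto simp: confs_def)
qed

lemma blk_merge:
  assumes S: "S \<in> confs" and l: "(a, b, u) \<in> enabled S" and i: "i \<in> {1..n}"
  shows "blk (merge S (a, b, u)) i =
    (if root S i = a \<or> root S i = b then comb u (blk S a) (blk S b) else blk S i)"
proof -
  note e = enabledD[OF S l]
  have iff: "blk S i = blk S c \<longleftrightarrow> root S i = c" if "root S c = c" "c \<in> {1..n}" for c
    using blk_eq_iff[OF S i that(2)] that by simp
  show ?thesis
  proof (rule blk_eq[OF merge_in[OF S l]])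
    show "(if root S i = a \<or> root S i = b then comb u (blk S a) (blk S b) else blk S i)
        \<in> merge S (a, b, u)"
      using blk_in[OF S i] iff[OF e(4,1)] iff[OF e(5,2)] by (auto simp: merge.simps)
    show "i \<in> supp (if root S i = a \<or> root S i = b then comb u (blk S a) (blk S b) else blk S i)"
      using blk_in[OF S i] iff[OF e(4,1)] iff[OF e(5,2)] supp_comb[OF e(11)] by auto
  qed
qed

lemma mn_comb: "mergeable X Y \<Longrightarrow> mn (comb u X Y) = mn X"
  using supp_comb[of X Y u] Min_Un[of "supp X" "supp Y"]
  by (auto simp: separated_def finite_supp supp_nonempty)

lemma root_merge:
  assumes S: "S \<in> confs" and l: "(a, b, u) \<in> enabled S" and i: "i \<in> {1..n}"
  shows "root (merge S (a, b, u)) i = (if root S i = b then a else root S i)"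
proof (cases "root S i = a \<or> root S i = b")
  case True
  then show ?thesis
    using enabledD[OF S l] blk_merge[OF assms] mn_comb by (auto simp: root_def[of "merge S (a, b, u)"])
next
  case False
  then show ?thesis using blk_merge[OF assms] by (simp add: root_def)
qed

lemma mins_merge:
  assumes S: "S \<in> confs" and l: "(a, b, u) \<in> enabled S"
  shows "mins (merge S (a, b, u)) = mins S - {b}"
proof -
  note e = enabledD[OF S l]
  have "mn ` (S - {blk S a, blk S b}) = mins S - {a, b}"
  proof (intro equalityI subsetI)
    fix x assume "x \<in> mn ` (S - {blk S a, blk S b})"
    then obtain X where X: "X \<in> S" "X \<noteq> blk S a" "X \<noteq> blk S b" "x = mn X" by blast
    then show "x \<in> mins S - {a, b}" using blk_mn[OF S X(1)] by (auto simp: mins_def)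
  next
    fix x assume "x \<in> mins S - {a, b}"
    then obtain X where "X \<in> S" "x = mn X" "x \<noteq> a" "x \<noteq> b" by (auto simp: mins_def)
    then show "x \<in> mn ` (S - {blk S a, blk S b})" using e(9,10) by blast
  qed
  then have "mins (merge S (a, b, u)) = insert a (mins S - {a, b})"
    using mn_comb[OF e(11)] e(9) by (simp add: merge.simps mins_def)
  moreover have "a \<in> mins S" using l by (simp add: enabled_def)
  ultimately show ?thesis using e(3) by auto
qed

lemma card_mins: "S \<in> confs \<Longrightarrow> card (mins S) \<le> n"
  using card_mono[OF _ mins_subset] by force

definition rk :: "'o set \<Rightarrow> nat" where
  "rk S = n - card (mins S)"

abbreviation "bottom \<equiv> base ` {1..n}"

lemma bottom_in: "bottom \<in> confs"
  by (auto simp: confs_def good_base supp_base pairwise_def)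

lemma mins_bottom: "mins bottom = {1..n}"
  by (auto simp: mins_def supp_base image_image)

text \<open>A configuration other than \<open>bottom\<close> contains a block that is not a base
  block; splitting this block by \<open>decompose\<close> undoes a merge.\<close>

lemma unmerge:
  assumes S: "S \<in> confs" and "S \<noteq> bottom"
  shows "\<exists>S'\<in>confs. \<exists>l\<in>enabled S'. S = merge S' l"
proof -
  have "\<exists>X\<in>S. \<forall>i. X \<noteq> base i"
  proof (rule ccontr)
    assume "\<not> (\<exists>X\<in>S. \<forall>i. X \<noteq> base i)"
    then have b: "\<And>X. X \<in> S \<Longrightarrow> \<exists>i. X = base i" by blast
    have U: "(\<Union>X\<in>S. supp X) = {1..n}" using S by (simp add: confs_def)
    have "S = bottom"
    proof safe
      fix X assume "X \<in> S"
      moreover from this b obtain i where "X = base i" by blast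
      ultimately show "X \<in> bottom" using U supp_base[of i] by blast
    next
      fix i assume "i \<in> {1..n}"
      then obtain X where "X \<in> S" "i \<in> supp X" using U by blast
      then show "base i \<in> S" using b[of X] supp_base by auto
    qed
    with assms(2) show False ..
  qed
  then obtain X where X: "X \<in> S" "\<forall>i. X \<noteq> base i" by blast
  then obtain u Y Z where YZ: "mergeable Y Z" "X = comb u Y Z"
    using decompose good_in[OF S] by blast
  have sX: "supp X = supp Y \<union> supp Z" using YZ supp_comb by simp
  have g: "good Y" "good Z" "disjnt (supp Y) (supp Z)" "mn Y < mn Z" using YZ by (auto simp: separated_def)
  let ?S = "insert Y (insert Z (S - {X}))"
  have dY: "disjnt (supp V) (supp Y)" "disjnt (supp V) (supp Z)" if "V \<in> S - {X}" for V
    using disjnt_supp[OF S _ X(1), of V] that sX by (auto simp: disjnt_Un2)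
  have "(\<Union>V\<in>?S. supp V) = (\<Union>V\<in>S. supp V)" using X(1) sX by auto
  then have C: "?S \<in> confs"
    using S g dY by (auto simp: confs_def pairwise_insert disjnt_sym pairwise_def)
  have "blk ?S (mn Y) = Y" "blk ?S (mn Z) = Z" using blk_mn[OF C] by auto
  moreover have "Y \<notin> S - {X}" "Z \<notin> S - {X}"
    using dY(1)[of Y] dY(2)[of Z] supp_nonempty[OF g(1)] supp_nonempty[OF g(2)]
    unfolding disjnt_self_iff_empty by blast+
  ultimately have "merge ?S (mn Y, mn Z, u) = S"
    using X(1) YZ(2) by (auto simp: merge.simps)
  moreover have "(mn Y, mn Z, u) \<in> enabled ?S" using g by (auto simp: enabled_def mins_def)
  ultimately show ?thesis using C by metis
qed

sublocale labelled_steps confs enabled merge bottom rk "{1..n} \<times> {1..n} \<times> UNIV" n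
proof
  show "bottom \<in> confs" by (rule bottom_in)
  show "rk bottom = 0" unfolding rk_def mins_bottom by simp
  show "finite ({1..n} \<times> {1..n} \<times> (UNIV :: bool set))" by simp
  fix S assume S: "S \<in> confs"
  show "rk S \<le> n" by (simp add: rk_def)
  show "enabled S \<subseteq> {1..n} \<times> {1..n} \<times> UNIV" using mins_subset[OF S] by (auto simp: enabled_def)
  show "\<exists>y\<in>confs. \<exists>l\<in>enabled y. S = merge y l" if "S \<noteq> bottom" using unmerge[OF S that] .
  \<comment> \<open>The label can be read off the result: \<open>b\<close> is the minimum that
    vanished, \<open>a\<close> is the new root of \<open>b\<close>, and the bit follows from
    \<open>comb_inject\<close>.\<close>
  show "inj_on (merge S) (enabled S)"
  proof (rule inj_onI)
    fix l l' assume l: "l \<in> enabled S" and l': "l' \<in> enabled S" and eq: "merge S l = merge S l'"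
    obtain a b u a' b' u' where [simp]: "l = (a, b, u)" "l' = (a', b', u')" by (cases l, cases l')
    note e = enabledD[OF S l[simplified]]
    have "mins S - {b} = mins S - {b'}"
      using mins_merge[OF S] eq l l' by (metis \<open>l = (a, b, u)\<close> \<open>l' = (a', b', u')\<close>)
    moreover have "b \<in> mins S" "b' \<in> mins S" using l l' by (auto simp: enabled_def)
    ultimately have b: "b' = b" by blast
    have r: "root (merge S (a, b, u)) b = root (merge S (a', b, u')) b" using eq b by simp
    then have a: "a' = a"
      using root_merge[OF S l[simplified] e(2)] root_merge[OF S _ e(2), of a' b u'] l' b e(5) by simp
    have "blk (merge S (a, b, u)) a = blk (merge S (a, b, u')) a" using eq a b by simp
    then have "comb u (blk S a) (blk S b) = comb u' (blk S a) (blk S b)"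
      using blk_merge[OF S l[simplified] e(1)] blk_merge[OF S _ e(1), of a b u'] l' a b e(4) by simp
    then have "u = u'" using comb_inject[OF e(11)] by blast
    with a b show "l = l'" by simp
  qed
  fix l assume l: "l \<in> enabled S"
  show "merge S l \<in> confs" by (rule merge_in[OF S l])
  obtain a b u where [simp]: "l = (a, b, u)" by (cases l)
  have "b \<in> mins S" using l by (simp add: enabled_def)
  moreover have "finite (mins S)" using mins_subset[OF S] finite_subset by blast
  ultimately have "Suc (card (mins S - {b})) = card (mins S)" by (metis card_Suc_Diff1)
  then show "rk (merge S l) = Suc (rk S)"
    using mins_merge[OF S l[simplified]] card_mins[OF S] by (simp add: rk_def)
qed

lemma step_iff:
  assumes S: "S \<in> confs"
  shows "step S S' \<longleftrightarrow>
    (\<exists>X Y u. X \<in> S \<and> Y \<in> S \<and> mn X < mn Y \<and> S' = insert (comb u X Y) (S - {X, Y}))"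
proof
  assume "step S S'"
  then obtain a b u where l: "(a, b, u) \<in> enabled S" "S' = merge S (a, b, u)" by (auto simp: step_def)
  then show "\<exists>X Y u. X \<in> S \<and> Y \<in> S \<and> mn X < mn Y \<and> S' = insert (comb u X Y) (S - {X, Y})"
    using enabledD[OF S l(1)] by (intro exI[of _ "blk S a"] exI[of _ "blk S b"]) (auto simp: merge.simps)
next
  assume "\<exists>X Y u. X \<in> S \<and> Y \<in> S \<and> mn X < mn Y \<and> S' = insert (comb u X Y) (S - {X, Y})"
  then obtain X Y u where "X \<in> S" "Y \<in> S" "mn X < mn Y" "S' = insert (comb u X Y) (S - {X, Y})"
    by blast
  then have "(mn X, mn Y, u) \<in> enabled S" "S' = merge S (mn X, mn Y, u)"
    by (auto simp: merge.simps enabled_def mins_def blk_mn[OF S])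
  then show "step S S'" by (auto simp: step_def)
qed

lemma path_iff: "S \<in> confs \<Longrightarrow> path S w \<longleftrightarrow> merge_word (mins S) w"
proof (induction w arbitrary: S)
  case (Cons l w)
  obtain a b u where [simp]: "l = (a, b, u)" by (cases l)
  have e: "l \<in> enabled S \<longleftrightarrow> a \<in> mins S \<and> b \<in> mins S \<and> a < b" by (simp add: enabled_def)
  show ?case
  proof (cases "l \<in> enabled S")
    case True
    then show ?thesis
      using Cons.IH[OF merge_in[OF Cons.prems True]] mins_merge[OF Cons.prems, of a b u] e
      by simp
  next
    case False
    then show ?thesis using e by (auto)
  qed
qed simp

lemma path_bottom: "path bottom w \<longleftrightarrow> merge_word {1..n} w"
  using path_iff[OF bottom_in] mins_bottom by simp

section \<open>Exchanging two consecutive merges\<close>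

lemma comb_not_in:
  assumes S: "S \<in> confs" "X \<in> S" "Y \<in> S" "Z \<in> S" "mergeable X Y" "Z \<noteq> X"
  shows "comb u X Y \<noteq> Z"
proof
  assume "comb u X Y = Z"
  then have "supp X \<subseteq> supp Z" using supp_comb[OF S(5), of u] by auto
  moreover have "disjnt (supp Z) (supp X)" by (rule disjnt_supp) (use S in auto)
  ultimately show False using supp_nonempty[of X] S(5) by (auto simp: separated_def disjnt_def)
qed

lemma merge_merge_commute:
  assumes S: "S \<in> confs" and l: "(a, b, u) \<in> enabled S" and l': "(c, d, v) \<in> enabled S"
    and ne: "a \<noteq> c" "a \<noteq> d" "b \<noteq> c" "b \<noteq> d"
  shows "merge (merge S (a, b, u)) (c, d, v) = merge (merge S (c, d, v)) (a, b, u)"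
proof -
  note e = enabledD[OF S l] and e' = enabledD[OF S l']
  let ?A = "blk S a" and ?B = "blk S b" and ?C = "blk S c" and ?D = "blk S d"
  have 1: "blk (merge S (a, b, u)) c = ?C" "blk (merge S (a, b, u)) d = ?D"
    using blk_merge[OF S l e'(1)] blk_merge[OF S l e'(2)] ne e'(4,5) by auto
  have 2: "blk (merge S (c, d, v)) a = ?A" "blk (merge S (c, d, v)) b = ?B"
    using blk_merge[OF S l' e(1)] blk_merge[OF S l' e(2)] ne e(4,5) by auto
  have ne': "?A \<noteq> ?C" "?A \<noteq> ?D" "?B \<noteq> ?C" "?B \<noteq> ?D" using ne e(9,10) e'(9,10) by auto
  have 3: "comb u ?A ?B \<noteq> ?C" "comb u ?A ?B \<noteq> ?D" "comb v ?C ?D \<noteq> ?A" "comb v ?C ?D \<noteq> ?B"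
    using comb_not_in[OF S e(6,7) e'(6) e(11)] comb_not_in[OF S e(6,7) e'(7) e(11)]
      comb_not_in[OF S e'(6,7) e(6) e'(11)] comb_not_in[OF S e'(6,7) e(7) e'(11)] ne' by metis+
  have "merge (merge S (a, b, u)) (c, d, v) =
      insert (comb v ?C ?D) (merge S (a, b, u) - {?C, ?D})"
    using 1 by (simp only: merge.simps[of _ c])
  also have "\<dots> = insert (comb u ?A ?B) (merge S (c, d, v) - {?A, ?B})"
    unfolding merge.simps using 3 by auto
  also have "\<dots> = merge (merge S (c, d, v)) (a, b, u)"
    using 2 by (simp only: merge.simps[of _ a])
  finally show ?thesis .
qed

lemma merge_merge_star:
  assumes S: "S \<in> confs" and l: "(a, b, u) \<in> enabled S" and l': "(a, c, v) \<in> enabled S" and ne: "b \<noteq> c"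
  shows "merge (merge S (a, b, u)) (a, c, v) =
    insert (comb v (comb u (blk S a) (blk S b)) (blk S c)) (S - {blk S a, blk S b, blk S c})"
proof -
  note e = enabledD[OF S l] and e' = enabledD[OF S l']
  let ?A = "blk S a" and ?B = "blk S b" and ?C = "blk S c"
  have "blk (merge S (a, b, u)) c = ?C" "blk (merge S (a, b, u)) a = comb u ?A ?B"
    using blk_merge[OF S l e'(1)] blk_merge[OF S l e'(2)] ne e'(3,4,5) by auto
  moreover have "comb u ?A ?B \<notin> S - {?A}"
    using comb_not_in[OF S e(6,7) _ e(11)] by auto
  ultimately show ?thesis by (auto simp: merge.simps)
qed

lemma merge_merge_chain:
  assumes S: "S \<in> confs" and l: "(b, c, u) \<in> enabled S" and l': "(a, b, v) \<in> enabled S"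
  shows "merge (merge S (b, c, u)) (a, b, v) =
    insert (comb v (blk S a) (comb u (blk S b) (blk S c))) (S - {blk S a, blk S b, blk S c})"
proof -
  note e = enabledD[OF S l] and e' = enabledD[OF S l']
  let ?A = "blk S a" and ?B = "blk S b" and ?C = "blk S c"
  have "blk (merge S (b, c, u)) a = ?A" "blk (merge S (b, c, u)) b = comb u ?B ?C"
    using blk_merge[OF S l e'(1)] blk_merge[OF S l e'(2)] e(3) e'(3,4,5) by auto
  moreover have "comb u ?B ?C \<notin> S - {?B}"
    using comb_not_in[OF S e(6,7) _ e(11)] by auto
  ultimately show ?thesis by (auto simp: merge.simps)
qed

text \<open>Merging only deletes minima, so the second label was enabled from the start. In an
  ascent the first minimum \<open>a\<close> satisfies a \<le> c < d, so it survives the merge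
  labelled \<open>l'\<close>. If \<open>a = c\<close>, \<open>comb_commute\<close> applies;
  otherwise the four minima involved are distinct, since \<open>b\<close> is gone when
  \<open>l'\<close> is executed.\<close>

lemma ascent_swap:
  assumes S: "S \<in> confs" and l: "l \<in> enabled S" and l': "l' \<in> enabled (merge S l)"
    and lt: "label_less l l'"
  shows "l' \<in> enabled S" "l \<in> enabled (merge S l')" "merge (merge S l') l = merge (merge S l) l'"
proof -
  obtain a b u c d v where [simp]: "l = (a, b, u)" "l' = (c, d, v)" by (cases l, cases l')
  note e = enabledD[OF S l[simplified]]
  have m: "c \<in> mins S" "d \<in> mins S" "c \<noteq> b" "d \<noteq> b" "c < d" "a \<in> mins S" "b \<in> mins S" "a < b"
    using l l' mins_merge[OF S, of a b u] by (auto simp: enabled_def)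
  show l'S: "l' \<in> enabled S" using m by (simp add: enabled_def)
  note e' = enabledD[OF S l'S[simplified]]
  have "a \<noteq> d" using lt m by auto
  then show "l \<in> enabled (merge S l')"
    using m mins_merge[OF S, of c d v] l'S by (simp add: enabled_def)
  show "merge (merge S l') l = merge (merge S l) l'"
  proof (cases "a = c")
    case False
    then show ?thesis
      using merge_merge_commute[OF S l[simplified] l'S[simplified]] m \<open>a \<noteq> d\<close> by auto
  next
    case True
    have uv: "u \<le> v" "b < d" using lt True m by auto
    have "blk S b \<noteq> blk S d" using e(10) e'(10) uv by auto
    then have "mergeable (blk S b) (blk S d)"
      using e(7,10) e'(7,10) uv disjnt_supp[OF S e(7) e'(7)] good_in[OF S] by (simp add: separated_def)
    then have "comb v (comb u (blk S a) (blk S b)) (blk S d) = comb u (comb v (blk S a) (blk S d)) (blk S b)"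
      using comb_commute e(11) e'(11) uv True by simp
    moreover have "merge (merge S l) l' =
        insert (comb v (comb u (blk S a) (blk S b)) (blk S d)) (S - {blk S a, blk S b, blk S d})"
      using merge_merge_star[OF S, of a b u d v] l l'S True m by simp
    moreover have "merge (merge S l') l =
        insert (comb u (comb v (blk S a) (blk S d)) (blk S b)) (S - {blk S a, blk S d, blk S b})"
      using merge_merge_star[OF S, of a d v b u] l l'S True m by simp
    moreover have "{blk S a, blk S d, blk S b} = {blk S a, blk S b, blk S d}" by blast
    ultimately show ?thesis by (simp only:)
  qed
qed

end

section \<open>What the end of a path reveals about an ascending word\<close>

lemma transp_label_less: "transp label_less"
proof (rule transpI)
  fix x y z assume "label_less x y" "label_less y z"
  then show "label_less x z" by (cases x; cases y; cases z) auto
qed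

lemma asymp_label_less: "label_less x y \<Longrightarrow> \<not> label_less y x"
  by (cases x; cases y) auto

context merge_system
begin

lemma mins_exec:
  "S \<in> confs \<Longrightarrow> path S w \<Longrightarrow> mins (exec S w) = mins S - (\<lambda>(a, b, u). b) ` set w"
proof (induction w arbitrary: S)
  case (Cons l w)
  obtain a b u where l: "l = (a, b, u)" by (cases l)
  have "mins (merge S l) = mins S - {b}" using mins_merge[of S a b u] Cons.prems l by simp
  then show ?case using Cons.IH[of "merge S l"] Cons.prems act_in[of S l] by (auto simp: l)
qed simp

lemma path_ConsD:
  assumes "S \<in> confs" "path S ((a, b, u) # w)"
  shows "(a, b, u) \<in> enabled S" "merge S (a, b, u) \<in> confs" "path (merge S (a, b, u)) w"
    "mins (merge S (a, b, u)) = mins S - {b}" "a \<in> mins S" "b \<in> mins S" "a < b"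
  using assms act_in mins_merge by (auto simp: enabled_def)

lemma path_label:
  "S \<in> confs \<Longrightarrow> path S w \<Longrightarrow> (a, b, u) \<in> set w \<Longrightarrow> a \<in> mins S \<and> b \<in> mins S \<and> a < b"
proof (induction w arbitrary: S)
  case (Cons l w)
  obtain c d v where l: "l = (c, d, v)" by (cases l)
  note P = path_ConsD[OF Cons.prems(1) Cons.prems(2)[unfolded l]]
  show ?case
  proof (cases "l = (a, b, u)")
    case True
    then show ?thesis using P l by simp
  next
    case False
    then have "(a, b, u) \<in> set w" using Cons.prems(3) by auto
    from Cons.IH[OF P(2,3) this] show ?thesis unfolding P(4) by blast
  qed
qed simp

lemma path_distinct:
  "S \<in> confs \<Longrightarrow> path S w \<Longrightarrow> distinct (map (\<lambda>(a, b, u). b) w)"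
proof (induction w arbitrary: S)
  case (Cons l w)
  obtain c d v where l: "l = (c, d, v)" by (cases l)
  note P = path_ConsD[OF Cons.prems(1) Cons.prems(2)[unfolded l]]
  have "b \<noteq> d" if "(a, b, u) \<in> set w" for a b u
    using path_label[OF P(2,3) that] P(4) by blast
  then show ?case using Cons.IH[OF P(2,3)] by (auto simp: l)
qed simp

lemma root_exec:
  "S \<in> confs \<Longrightarrow> path S w \<Longrightarrow> i \<in> {1..n} \<Longrightarrow> root S i \<notin> (\<lambda>(a, b, u). b) ` set w \<Longrightarrow>
    root (exec S w) i = root S i"
proof (induction w arbitrary: S)
  case (Cons l w)
  obtain c d v where l: "l = (c, d, v)" by (cases l)
  have "root (merge S l) i = root S i" using root_merge[of S c d v i] Cons.prems l by auto
  then show ?case using Cons.IH[of "merge S l"] Cons.prems act_in[of S l] by auto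
qed simp

text \<open>Labels after \<open>(a, b, u)\<close> have first entry at least \<open>a\<close>, hence
  second entry above \<open>a\<close>. So \<open>a\<close> is never absorbed afterwards and remains
  the root of \<open>b\<close>.\<close>

lemma root_exec_ascending:
  "S \<in> confs \<Longrightarrow> path S w \<Longrightarrow> sorted_wrt label_less w \<Longrightarrow> (a, b, u) \<in> set w \<Longrightarrow>
    root (exec S w) b = a"
proof (induction w arbitrary: S)
  case (Cons l w)
  show ?case
  proof (cases "l = (a, b, u)")
    case True
    have S': "merge S l \<in> confs" "path (merge S l) w" using Cons.prems act_in[of S l] by auto
    have b: "b \<in> {1..n}" "root S b = b" using enabledD[of S a b u] Cons.prems True by auto
    have "a \<le> c \<and> c < d" if "(c, d, v) \<in> set w" for c d v
      using Cons.prems(3) path_label[OF S' that] that by (fastforce simp: True)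
    then have "a \<notin> (\<lambda>(a, b, u). b) ` set w" by fastforce
    moreover have "root (merge S l) b = a" using root_merge[of S a b u b] Cons.prems True b by auto
    ultimately show ?thesis using root_exec[OF S' b(1)] by simp
  next
    case False
    then show ?thesis using Cons act_in[of S l] by auto
  qed
qed simp

text \<open>The second entries are the minima that vanish, and the matching first entry is the root
  at the end; both depend only on the endpoints.\<close>

lemma ascending_pairs:
  assumes S: "S \<in> confs" and w: "path S w" "sorted_wrt label_less w"
    and w': "path S w'" "sorted_wrt label_less w'" and eq: "exec S w = exec S w'"
    and l: "(a, b, u) \<in> set w"
  shows "\<exists>u'. (a, b, u') \<in> set w'"
proof -
  have "b \<in> mins S" using path_label[OF S w(1) l] by simp
  moreover have "b \<notin> mins (exec S w)" using mins_exec[OF S w(1)] l by force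
  ultimately obtain a' u' where "(a', b, u') \<in> set w'"
    using mins_exec[OF S w'(1)] eq by force
  moreover from this have "a' = a"
    using root_exec_ascending[OF S w l] root_exec_ascending[OF S w'] eq by auto
  ultimately show ?thesis by blast
qed

end

lemma label_less_fst: "label_less l l' \<Longrightarrow> fst l \<le> fst l'"
  by (cases l; cases l') auto

lemma ascending_fst: "sorted_wrt label_less (l # w) \<Longrightarrow> \<forall>l'\<in>set (l # w). fst l \<le> fst l'"
  using label_less_fst[of l] by auto

text \<open>Within one value of \<open>a\<close> the order of second entries is forced, so their
  list is determined by their set.\<close>

lemma ascending_star:
  assumes "sorted_wrt label_less w" "distinct (map (\<lambda>(a, b, u). b) w)"
  shows "sorted_wrt (<) (map (\<lambda>(a, b, u). b) (filter (\<lambda>l. fst l = a) w))"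
  using assms
proof (induction w)
  case (Cons l w)
  obtain c d v where l: "l = (c, d, v)" by (cases l)
  have "d < b" if "(a, b, u) \<in> set w" "c = a" for b u
    using Cons.prems that by (force simp: l)
  then show ?case using Cons by (auto simp: l)
qed simp


section \<open>Weighted partitions\<close>

definition wcomb :: "bit \<Rightarrow> weighted_set \<Rightarrow> weighted_set \<Rightarrow> weighted_set" where
  "wcomb u X Y = (fst X \<union> fst Y, snd X + snd Y + of_bool u)"

lemma is_weighted_set_iff: "is_weighted_set X \<longleftrightarrow> finite (fst X) \<and> fst X \<noteq> {} \<and> snd X < card (fst X)"
proof (cases X)
  case (Pair A v)
  have "finite A \<and> A \<noteq> {} \<longleftrightarrow> 0 < card A" by (auto simp: card_gt_0_iff)
  then show ?thesis by (auto simp: Pair is_weighted_set_def)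
qed

text \<open>The bound on weights is tight: (|A| - 1) + (|B| - 1) + 1 = |A| + |B| - 1.\<close>

lemma is_weighted_set_wcomb:
  assumes "separated is_weighted_set fst X Y"
  shows "is_weighted_set (wcomb u X Y)"
proof -
  have "card (fst X \<union> fst Y) = card (fst X) + card (fst Y)"
    using assms by (intro card_Un_disjnt) (auto simp: separated_def is_weighted_set_iff)
  then show ?thesis
    using assms by (auto simp: separated_def is_weighted_set_iff wcomb_def)
qed

text \<open>The largest element is split off with weight 0. One unit of a positive weight goes into
  the bit, so that the rest respects the smaller bound for one element fewer.\<close>

lemma weighted_set_decompose:
  assumes X: "is_weighted_set X" and ns: "\<nexists>i. X = ({i}, 0)"
  shows "\<exists>u Y Z. separated is_weighted_set fst Y Z \<and> X = wcomb u Y Z"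
proof -
  obtain A v where [simp]: "X = (A, v)" by (cases X)
  have A: "finite A" "A \<noteq> {}" "v < card A" using X by (auto simp: is_weighted_set_iff)
  have "card A \<noteq> 1" using A ns by (auto simp: card_1_singleton_iff)
  let ?m = "Max A" and ?B = "A - {Max A}"
  have m: "?m \<in> A" using A by simp
  have B: "finite ?B" "card ?B = card A - 1" using A m by auto
  with \<open>card A \<noteq> 1\<close> A have "?B \<noteq> {}" by (metis One_nat_def Suc_diff_1 card.empty card_gt_0_iff)
  moreover from this have "Min ?B < ?m"
    using A B Min_in[of ?B] Max_ge[of A "Min ?B"] by (metis Diff_iff insertI1 le_neq_implies_less)
  ultimately have "separated is_weighted_set fst (?B, v - of_bool (v > 0)) ({?m}, 0)"
    using A B \<open>card A \<noteq> 1\<close> by (auto simp: separated_def is_weighted_set_iff)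
  moreover have "X = wcomb (v > 0) (?B, v - of_bool (v > 0)) ({?m}, 0)"
    using m by (auto simp: wcomb_def)
  ultimately show ?thesis by blast
qed

interpretation wp: merge_system is_weighted_set fst wcomb "\<lambda>i. ({i}, 0)" n for n
proof
  fix X :: weighted_set
  assume "is_weighted_set X"
  then show "(\<exists>i. X = ({i}, 0)) \<or> (\<exists>u Y Z. separated is_weighted_set fst Y Z \<and> X = wcomb u Y Z)"
    using weighted_set_decompose by blast
next
  fix X Y :: weighted_set and u v :: bit
  show "separated is_weighted_set fst X Y \<Longrightarrow> is_weighted_set (wcomb u X Y)"
    by (rule is_weighted_set_wcomb)
  show "wcomb u X Y = wcomb v X Y \<Longrightarrow> u = v"
    by (cases u; cases v) (auto simp: wcomb_def)
qed (auto simp: is_weighted_set_iff wcomb_def)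

lemma confs_wp: "wp.confs n = weighted_partitions n"
proof -
  have "pairwise (\<lambda>X Y. disjnt (fst X) (fst Y)) \<pi> \<longleftrightarrow> inj_on fst \<pi> \<and> disjoint (fst ` \<pi>)"
    if "\<forall>X\<in>\<pi>. is_weighted_set X" for \<pi>
    using that
    by (fastforce simp: pairwise_def disjoint_def disjnt_def inj_on_def is_weighted_set_iff)
  then show ?thesis
    by (auto simp: wp.confs_def weighted_partitions_def partition_on_def is_weighted_set_iff)
qed

lemma merge_blocks_wcomb: "merge_blocks A a B b u \<pi> = insert (wcomb u (A, a) (B, b)) (\<pi> - {(A, a), (B, b)})"
  by (simp add: merge_blocks_def wcomb_def)

lemma wp_step_iff:
  assumes \<pi>: "\<pi> \<in> wp.confs n"
  shows "wp_step \<pi> \<pi>' \<longleftrightarrow> wp.step \<pi> \<pi>'"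
  unfolding wp.step_iff[OF \<pi>]
proof
  assume "wp_step \<pi> \<pi>'"
  then obtain A a B b u where s: "(A, a) \<in> \<pi>" "(B, b) \<in> \<pi>" "A \<noteq> B" "\<pi>' = merge_blocks A a B b u \<pi>"
    unfolding wp_step_def by blast
  have "Min A \<noteq> Min B"
    using wp.blk_mn[OF \<pi> s(1)] wp.blk_mn[OF \<pi> s(2)] s(3) by (metis fst_conv)
  then consider "Min A < Min B" | "Min B < Min A" by linarith
  then show "\<exists>X Y u. X \<in> \<pi> \<and> Y \<in> \<pi> \<and> Min (fst X) < Min (fst Y) \<and> \<pi>' = insert (wcomb u X Y) (\<pi> - {X, Y})"
  proof cases
    case 1
    then show ?thesis using s
      by (intro exI[of _ "(A, a)"] exI[of _ "(B, b)"] exI[of _ u]) (simp add: merge_blocks_wcomb)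
  next
    case 2
    then show ?thesis using s
      by (intro exI[of _ "(B, b)"] exI[of _ "(A, a)"] exI[of _ u])
        (auto simp: merge_blocks_wcomb wcomb_def)
  qed
next
  assume "\<exists>X Y u. X \<in> \<pi> \<and> Y \<in> \<pi> \<and> Min (fst X) < Min (fst Y) \<and> \<pi>' = insert (wcomb u X Y) (\<pi> - {X, Y})"
  then obtain A a B b u where "(A, a) \<in> \<pi>" "(B, b) \<in> \<pi>" "Min A < Min B"
    "\<pi>' = insert (wcomb u (A, a) (B, b)) (\<pi> - {(A, a), (B, b)})"
    by auto
  then show "wp_step \<pi> \<pi>'" unfolding wp_step_def merge_blocks_wcomb by (metis less_irrefl)
qed

lemma generated_order_cong:
  assumes "\<And>x y. x \<in> C \<Longrightarrow> s x y \<longleftrightarrow> t x y"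
  shows "generated_order C s = generated_order C t"
proof -
  have "{(a, b). a \<in> C \<and> b \<in> C \<and> s a b} = {(a, b). a \<in> C \<and> b \<in> C \<and> t a b}"
    using assms by blast
  then show ?thesis by (simp add: generated_order_def)
qed

lemma Pi_w_ord: "Pi_w n = wp.ord n"
  unfolding Pi_w_def confs_wp[symmetric] by (rule generated_order_cong) (rule wp_step_iff)

text \<open>The description defining \<open>lambda_w\<close> is unique because distinct enabled
  labels lead to distinct partitions.\<close>

lemma lambda_w_merge:
  assumes \<pi>: "\<pi> \<in> wp.confs n" and l: "l \<in> wp.enabled \<pi>"
  shows "lambda_w \<pi> (wp.merge \<pi> l) = l"
  unfolding lambda_w_def
proof (rule the_equality)
  obtain a b u where [simp]: "l = (a, b, u)" by (cases l)
  note e = wp.enabledD[OF \<pi> l[simplified]]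
  obtain A v B w where AB: "wp.blk \<pi> a = (A, v)" "wp.blk \<pi> b = (B, w)" by fastforce
  show "\<exists>A v B w u. (A, v) \<in> \<pi> \<and> (B, w) \<in> \<pi> \<and> Min A < Min B \<and>
      wp.merge \<pi> l = merge_blocks A v B w u \<pi> \<and> l = (Min A, Min B, u)"
    using e AB
    by (intro exI[of _ A] exI[of _ v] exI[of _ B] exI[of _ w] exI[of _ u])
      (auto simp: merge_blocks_wcomb wp.merge.simps)
  fix l'
  assume "\<exists>A v B w u. (A, v) \<in> \<pi> \<and> (B, w) \<in> \<pi> \<and> Min A < Min B \<and>
      wp.merge \<pi> l = merge_blocks A v B w u \<pi> \<and> l' = (Min A, Min B, u)"
  then obtain A v B w u' where s: "(A, v) \<in> \<pi>" "(B, w) \<in> \<pi>" "Min A < Min B"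
      "wp.merge \<pi> l = merge_blocks A v B w u' \<pi>" "l' = (Min A, Min B, u')"
    by blast
  have "l' \<in> wp.enabled \<pi>" using s by (force simp: wp.enabled_def wp.mins_def)
  moreover have "wp.merge \<pi> l' = wp.merge \<pi> l"
    using wp.blk_mn[OF \<pi> s(1)] wp.blk_mn[OF \<pi> s(2)] s(4,5)
    by (simp add: wp.merge.simps merge_blocks_wcomb)
  ultimately show "l' = l" using inj_onD[OF wp.inj_act[OF \<pi>]] l by blast
qed

section \<open>Unique ascending words for weighted partitions\<close>

lemma wp_descent_replace:
  assumes \<pi>: "\<pi> \<in> wp.confs n" and l: "l \<in> wp.enabled \<pi>" and l': "l' \<in> wp.enabled (wp.merge \<pi> l)"
    and nlt: "\<not> label_less l l'"
  shows "\<exists>m m'. m \<in> wp.enabled \<pi> \<and> m' \<in> wp.enabled (wp.merge \<pi> m) \<and>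
    wp.merge (wp.merge \<pi> m) m' = wp.merge (wp.merge \<pi> l) l' \<and>
    (m, l) \<in> less_than <*lex*> less_than <*lex*> {(False, True)}"
proof -
  obtain a b u c d v where [simp]: "l = (a, b, u)" "l' = (c, d, v)" by (cases l, cases l')
  have m: "a \<in> wp.mins \<pi>" "b \<in> wp.mins \<pi>" "a < b" "c \<in> wp.mins \<pi>" "d \<in> wp.mins \<pi>" "c < d"
    "c \<noteq> b" "d \<noteq> b"
    using l l' wp.mins_merge[OF \<pi>, of a b u] by (auto simp: wp.enabled_def)
  have en: "(p, q, t) \<in> wp.enabled \<pi>" if "p \<in> wp.mins \<pi>" "q \<in> wp.mins \<pi>" "p < q" for p q t
    using that by (simp add: wp.enabled_def)
  have en': "(p', q', t') \<in> wp.enabled (wp.merge \<pi> (p, q, t))"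
    if "p \<in> wp.mins \<pi>" "q \<in> wp.mins \<pi>" "p < q" "p' \<in> wp.mins \<pi>" "q' \<in> wp.mins \<pi>" "p' < q'"
      "p' \<noteq> q" "q' \<noteq> q" for p q t p' q' t'
    using that wp.mins_merge[OF \<pi> en[OF that(1-3), of t]] by (simp add: wp.enabled_def)
  \<comment> \<open>The ways of not ascending: merges of disjoint pairs in the wrong order, a chain
    in which \<open>a\<close> is absorbed next, and two merges into the same block with wrongly
    ordered bits or wrongly ordered minima.\<close>
  consider "c < a" "d \<noteq> a" | "c < a" "d = a" | "c = a" "b < d" "u" "\<not> v" | "c = a" "d < b"
  proof -
    from nlt \<open>d \<noteq> b\<close> have "c < a \<or> c = a \<and> (d < b \<or> b < d \<and> u \<and> \<not> v)"
      by (cases u; cases v; simp; linarith)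
    with that show thesis by blast
  qed
  then show ?thesis
  proof cases
    case 1
    have "wp.merge (wp.merge \<pi> l') l = wp.merge (wp.merge \<pi> l) l'"
      using wp.merge_merge_commute[OF \<pi> en[OF m(4-6), of v] en[OF m(1-3), of u]] 1 m(7,8) by simp
    moreover have "l' \<in> wp.enabled \<pi>" "l \<in> wp.enabled (wp.merge \<pi> l')"
      using en[OF m(4-6)] en'[OF m(4-6) m(1-3)] 1(2) m(8) by simp_all
    ultimately show ?thesis using 1(1) by (intro exI[of _ l'] exI[of _ l]) simp
  next
    case 2
    have "c < b" using 2 m(3) by simp
    \<comment> \<open>Only the total of the bits enters the weight, and conjunction and disjunction
      have the same total as \<open>u\<close> and \<open>v\<close>. This choice also puts the
      smaller bit first.\<close>
    have "wp.merge (wp.merge \<pi> (c, a, u \<and> v)) (c, b, u \<or> v) = wp.merge (wp.merge \<pi> (a, b, u)) (c, a, v)"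
      unfolding wp.merge_merge_star[OF \<pi> en[OF m(4,1) 2(1)] en[OF m(4,2) \<open>c < b\<close>] less_imp_neq[OF m(3)]]
        wp.merge_merge_chain[OF \<pi> en[OF m(1-3)] en[OF m(4,1) 2(1)]]
      by (auto simp: wcomb_def)
    moreover have "(c, a, u \<and> v) \<in> wp.enabled \<pi>"
      "(c, b, u \<or> v) \<in> wp.enabled (wp.merge \<pi> (c, a, u \<and> v))"
      using en[OF m(4,1) 2(1)] en'[OF m(4,1) 2(1) m(4,2) \<open>c < b\<close>] 2 m(3) by simp_all
    ultimately show ?thesis using 2
      by (intro exI[of _ "(c, a, u \<and> v)"] exI[of _ "(c, b, u \<or> v)"]) simp
  next
    case 3
    have "a < d" using 3 m(6) by simp
    have "wp.merge (wp.merge \<pi> (a, b, False)) (a, d, True) = wp.merge (wp.merge \<pi> (a, b, True)) (a, d, False)"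
      unfolding wp.merge_merge_star[OF \<pi> en[OF m(1-3)] en[OF m(1,5) \<open>a < d\<close>] less_imp_neq[OF 3(2)]]
      by (simp add: wcomb_def)
    moreover have "(a, b, False) \<in> wp.enabled \<pi>"
      "(a, d, True) \<in> wp.enabled (wp.merge \<pi> (a, b, False))"
      using en[OF m(1-3)] en'[OF m(1-3) m(1,5) \<open>a < d\<close>] m(3,8) by simp_all
    ultimately show ?thesis using 3
      by (intro exI[of _ "(a, b, False)"] exI[of _ "(a, d, True)"]) simp
  next
    case 4
    have "a < d" using 4 m(6) by simp
    have "wp.merge (wp.merge \<pi> (a, d, v)) (a, b, u) = wp.merge (wp.merge \<pi> (a, b, u)) (a, d, v)"
      unfolding wp.merge_merge_star[OF \<pi> en[OF m(1-3)] en[OF m(1,5) \<open>a < d\<close>] m(8)[symmetric]]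
        wp.merge_merge_star[OF \<pi> en[OF m(1,5) \<open>a < d\<close>] en[OF m(1-3)] m(8)]
      by (auto simp: wcomb_def)
    moreover have "(a, d, v) \<in> wp.enabled \<pi>" "(a, b, u) \<in> wp.enabled (wp.merge \<pi> (a, d, v))"
      using en[OF m(1,5) \<open>a < d\<close>] en'[OF m(1,5) \<open>a < d\<close> m(1-3)] m(3,8) \<open>a < d\<close> by simp_all
    ultimately show ?thesis using 4
      by (intro exI[of _ "(a, d, v)"] exI[of _ "(a, b, u)"]) simp
  qed
qed

text \<open>All labels with first entry \<open>a\<close> come first in such a word, so each block
  absorbed by \<open>a\<close> still has its original weight at that moment.\<close>

lemma wp_weight_ascending:
  "\<pi> \<in> wp.confs n \<Longrightarrow> wp.path \<pi> w \<Longrightarrow> sorted_wrt label_less w \<Longrightarrow> a \<in> wp.mins \<pi> \<Longrightarrow>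
    \<forall>l\<in>set w. a \<le> fst l \<Longrightarrow>
    snd (wp.blk (wp.exec \<pi> w) a) = snd (wp.blk \<pi> a) +
      (\<Sum>(c, b, u)\<leftarrow>filter (\<lambda>l. fst l = a) w. snd (wp.blk \<pi> b) + of_bool u)"
proof (induction w arbitrary: \<pi>)
  case (Cons l w)
  obtain c b u where [simp]: "l = (c, b, u)" by (cases l)
  note P = wp.path_ConsD[OF Cons.prems(1) Cons.prems(2)[simplified \<open>l = (c, b, u)\<close>]]
  have a: "root a = a" "a \<in> {1..n}" if "root = wp.root \<pi>" for root
    using wp.root_min[OF Cons.prems(1,4)] wp.mins_subset[OF Cons.prems(1)] Cons.prems(4) that by auto
  have "a \<le> c" "c < b" using Cons.prems(5) P(7) by auto
  then have "a \<in> wp.mins (wp.merge \<pi> l)" using P(4) Cons.prems(4) by auto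
  with Cons.IH[OF P(2,3)] Cons.prems
  have IH: "snd (wp.blk (wp.exec (wp.merge \<pi> l) w) a) = snd (wp.blk (wp.merge \<pi> l) a) +
      (\<Sum>(c, b, u)\<leftarrow>filter (\<lambda>l. fst l = a) w. snd (wp.blk (wp.merge \<pi> l) b) + of_bool u)"
    by simp
  have blk_a: "wp.blk (wp.merge \<pi> l) a = (if a = c then wcomb u (wp.blk \<pi> c) (wp.blk \<pi> b) else wp.blk \<pi> a)"
    using wp.blk_merge[OF Cons.prems(1) P(1), of a] a[OF refl] \<open>a \<le> c\<close> \<open>c < b\<close> by auto
  have blk_d: "wp.blk (wp.merge \<pi> l) d = wp.blk \<pi> d" if "(a, d, v) \<in> set w" for d v
  proof -
    have "d \<in> wp.mins \<pi>" "d \<noteq> b" "a < d"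
      using wp.path_label[OF P(2,3) that] P(4) by auto
    moreover have "c \<le> a" using Cons.prems(3) that label_less_fst[of l "(a, d, v)"] by auto
    moreover have "wp.root \<pi> d = d" "d \<in> {1..n}"
      using wp.root_min[OF Cons.prems(1)] wp.mins_subset[OF Cons.prems(1)] calculation by auto
    ultimately show ?thesis using wp.blk_merge[OF Cons.prems(1) P(1), of d] by auto
  qed
  have "(\<Sum>(c, b, u)\<leftarrow>filter (\<lambda>l. fst l = a) w. snd (wp.blk (wp.merge \<pi> l) b) + of_bool u) =
      (\<Sum>(c, b, u)\<leftarrow>filter (\<lambda>l. fst l = a) w. snd (wp.blk \<pi> b) + of_bool u)"
    using blk_d by (intro arg_cong[of _ _ sum_list] map_cong) auto
  moreover have "snd (wcomb u X Y) = snd X + snd Y + of_bool u" for X Y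
    by (simp add: wcomb_def)
  ultimately show ?case using IH blk_a by (cases "a = c") simp_all
qed simp

text \<open>Both words absorb the same blocks into \<open>a\<close>, so the final weight of that
  block compares bit sums. If the first bit is 1, ascent forces all of them to be 1; the other word
  starts with 0 and falls short.\<close>

lemma wp_first_color:
  assumes \<pi>: "\<pi> \<in> wp.confs n"
    and w: "wp.path \<pi> w" "sorted_wrt label_less w" "w = (a, b, False) # v"
    and w': "wp.path \<pi> w'" "sorted_wrt label_less w'" "w' = (a, b, True) # v'"
    and eq: "wp.exec \<pi> w = wp.exec \<pi> w'"
  shows False
proof -
  let ?f = "filter (\<lambda>l. fst l = a)" and ?g = "map (\<lambda>(a, b, u). b)"
  let ?W = "\<lambda>b. snd (wp.blk \<pi> b)"
  have sum: "(\<Sum>(c, b, u)\<leftarrow>?f z. ?W b + of_bool u) =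
      (\<Sum>b\<leftarrow>?g (?f z). ?W b) + (\<Sum>(c, b, u)\<leftarrow>?f z. of_bool u)" for z :: "label list"
    by (induction z) auto
  have set_g: "set (?g (?f z)) = {d. \<exists>u. (a, d, u) \<in> set z}" for z :: "label list"
    by force
  have "set (?g (?f w)) = set (?g (?f w'))"
    unfolding set_g using wp.ascending_pairs[OF \<pi> w(1,2) w'(1,2) eq]
      wp.ascending_pairs[OF \<pi> w'(1,2) w(1,2) eq[symmetric]] by blast
  then have g: "?g (?f w) = ?g (?f w')"
    using ascending_star w(2) w'(2) wp.path_distinct[OF \<pi>] w(1) w'(1)
    by (intro strict_sorted_equal) auto
  then have len: "length (?f w) = length (?f w')" by (metis length_map)
  have a: "a \<in> wp.mins \<pi>" using wp.path_label[OF \<pi> w(1)] w(3) by auto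
  have ge: "\<forall>l\<in>set w. a \<le> fst l" "\<forall>l\<in>set w'. a \<le> fst l"
    using ascending_fst[of "(a, b, False)" v] ascending_fst[of "(a, b, True)" v'] w(2,3) w'(2,3)
    by simp_all
  \<comment> \<open>The original weights cancel, because the lists of absorbed minima
    coincide.\<close>
  have "(\<Sum>(c, b, u)\<leftarrow>?f w. of_bool u) = (\<Sum>(c, b, u)\<leftarrow>?f w'. of_bool u :: nat)"
    using wp_weight_ascending[OF \<pi> w(1,2) a ge(1)] wp_weight_ascending[OF \<pi> w'(1,2) a ge(2)]
      eq g unfolding sum by simp
  moreover have "(\<Sum>(c, b, u)\<leftarrow>?f w'. of_bool u) = length (?f w')"
  proof -
    have "\<forall>l\<in>set (?f w'). snd (snd l)" using w'(2,3) by auto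
    moreover have "(\<Sum>(c, b, u)\<leftarrow>z. of_bool u :: nat) = length z" if "\<forall>l\<in>set z. snd (snd l)" for z :: "label list"
      using that by (induction z) auto
    ultimately show ?thesis by blast
  qed
  moreover have "(\<Sum>(c, b, u)\<leftarrow>z. of_bool u :: nat) \<le> length z" for z :: "label list"
    by (induction z) (auto simp: of_bool_def)
  from this[of "?f v"] have "(\<Sum>(c, b, u)\<leftarrow>?f w. of_bool u) < length (?f w)" using w(3) by simp
  ultimately show False using len by simp
qed

text \<open>The first pair of an ascending word is the lexicographically least of its pairs, hence
  common to both words; \<open>wp_first_color\<close> settles the bit, and the tails agree by
  induction.\<close>

lemma wp_ascending_unique:
  "\<pi> \<in> wp.confs n \<Longrightarrow> wp.path \<pi> w \<Longrightarrow> wp.path \<pi> w' \<Longrightarrow> sorted_wrt label_less w \<Longrightarrow>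
    sorted_wrt label_less w' \<Longrightarrow> wp.exec \<pi> w = wp.exec \<pi> w' \<Longrightarrow> w = w'"
proof (induction w arbitrary: \<pi> w')
  case Nil
  then show ?case using wp.rk_exec[OF Nil.prems(1,3)] wp.rk_exec[OF Nil.prems(1,2)] by simp
next
  case (Cons l w)
  note pi = Cons.prems(1)
  have "length w' = Suc (length w)"
    using wp.rk_exec[OF pi Cons.prems(3)] wp.rk_exec[OF pi Cons.prems(2)] Cons.prems(6) by simp
  then obtain l' v where w': "w' = l' # v" by (cases w') auto
  obtain a b u a' b' u' where [simp]: "l = (a, b, u)" "l' = (a', b', u')" by (cases l, cases l')
  have first: "c < e \<or> c = e \<and> d \<le> f"
    if "sorted_wrt label_less ((c, d, t) # z)" "(e, f, s) \<in> set ((c, d, t) # z)" for c d t z e f s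
    using that by auto
  have "\<exists>t. (a, b, t) \<in> set w'"
    using wp.ascending_pairs[OF pi Cons.prems(2,4,3,5,6), of a b u] by simp
  moreover have "\<exists>t. (a', b', t) \<in> set (l # w)"
    using wp.ascending_pairs[OF pi Cons.prems(3,5,2,4) Cons.prems(6)[symmetric], of a' b' u'] w' by simp
  ultimately have ab: "a' = a" "b' = b"
    using first[of a' b' u' v a b] first[of a b u w a' b'] Cons.prems(4,5) w' by fastforce+
  have "u = u'"
  proof (rule ccontr)
    assume "u \<noteq> u'"
    then consider "\<not> u" u' | u "\<not> u'" by blast
    then show False
    proof cases
      case 1
      then show False
        using wp_first_color[OF pi Cons.prems(2,4) _ Cons.prems(3,5) _ Cons.prems(6), of a b w v] ab w' by simp
    next
      case 2
      then show False
        using wp_first_color[OF pi Cons.prems(3,5) _ Cons.prems(2,4) _ Cons.prems(6)[symmetric], of a b v w] ab w' by simp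
    qed
  qed
  then have lv: "w' = l # v" using ab w' by simp
  have "w = v"
    by (rule Cons.IH[of "wp.merge \<pi> l"])
      (use Cons.prems[unfolded lv] wp.act_in[OF pi, of l] in simp_all)
  then show ?case using lv by simp
qed

lemma successively_label_less: "successively label_less w \<longleftrightarrow> sorted_wrt label_less w"
  by (rule successively_conv_sorted_wrt[OF transp_label_less])

theorem unique_paths_wp: "wp.unique_paths n label_less"
  unfolding wp.unique_paths_def
proof (intro ballI allI impI)
  fix \<pi> w assume \<pi>: "\<pi> \<in> wp.confs n" "wp.path \<pi> w"
  have wf: "wf (less_than <*lex*> less_than <*lex*> {(False, True)})"
  proof (intro wf_lex_prod wf_less_than)
    have "acyclic {(False, True)}" unfolding acyclic_def by (auto elim: trancl.cases)
    then show "wf {(False, True)}" by (simp add: finite_acyclic_wf)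
  qed
  have "\<exists>v. wp.path \<pi> v \<and> wp.exec \<pi> v = wp.exec \<pi> w \<and> successively label_less v"
    by (rule wp.exists_successively[OF wf _ \<pi>]) (rule wp_descent_replace)
  then obtain v where v: "wp.path \<pi> v" "wp.exec \<pi> v = wp.exec \<pi> w" "sorted_wrt label_less v"
    unfolding successively_label_less by blast
  show "\<exists>!v. wp.path \<pi> v \<and> wp.exec \<pi> v = wp.exec \<pi> w \<and> successively label_less v"
    unfolding successively_label_less
  proof (rule ex1I[of _ v])
    fix z assume "wp.path \<pi> z \<and> wp.exec \<pi> z = wp.exec \<pi> w \<and> sorted_wrt label_less z"
    then show "z = v" using wp_ascending_unique[OF \<pi>(1), of z v] v by simp
  qed (use v in simp)
qed

section \<open>Ascent-free words\<close>

text \<open>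
  Ascent-free words are normal forms of traces in which comparable letters commute: such a word
  is determined by its projections to pairs of incomparable letters.
\<close>

lemma successively_comparable_below:
  assumes "transp prec" "successively (\<lambda>x y. \<not> prec x y) (l # p)" "prec l m"
    and "\<forall>x\<in>set p. prec x m \<or> prec m x"
  shows "prec (last (l # p)) m"
  using assms(2-4)
proof (induction p arbitrary: l)
  case (Cons x p)
  have "\<not> prec l x" "prec x m \<or> prec m x" using Cons.prems(1,3) by simp_all
  then have "prec x m" using transpD[OF assms(1) Cons.prems(2)] by blast
  then show ?case using Cons by simp
qed simp

lemma ascent_free_eq:
  assumes tr: "transp prec" and as: "\<And>x y. prec x y \<Longrightarrow> \<not> prec y x"
  shows "successively (\<lambda>x y. \<not> prec x y) v \<Longrightarrow> successively (\<lambda>x y. \<not> prec x y) w \<Longrightarrow>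
    (\<And>x y. \<not> prec x y \<Longrightarrow> \<not> prec y x \<Longrightarrow>
      filter (\<lambda>l. l = x \<or> l = y) v = filter (\<lambda>l. l = x \<or> l = y) w) \<Longrightarrow> v = w"
proof (induction v arbitrary: w)
  case Nil
  have "l \<notin> set w" for l
    using Nil(3)[of l l, symmetric] as[of l l] by (auto simp: filter_empty_conv)
  then show ?case by (metis list.set_intros(1) neq_Nil_conv)
next
  case (Cons l v)
  have ir: "\<not> prec x x" for x using as by blast
  \<comment> \<open>A letter is incomparable to itself, so the projections with \<open>x = y\<close>
    show that both words contain the same letters.\<close>
  have mem: "l \<in> set w" using arg_cong[OF Cons.prems(3)[OF ir ir, of l], of set] by auto
  then obtain m z where w: "w = m # z" by (cases w) auto
  \<comment> \<open>Suppose the words begin with x < y. Every letter before the first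
    \<open>y\<close> in the word starting with \<open>x\<close> is comparable to \<open>y\<close>;
    otherwise its projection together with \<open>y\<close> would not begin with \<open>y\<close>.
    All these letters then stay below \<open>y\<close>, so the last of them and \<open>y\<close>
    form an ascent.\<close>
  have no: False
    if less: "prec x y" and desc: "successively (\<lambda>x y. \<not> prec x y) (x # p)"
      and eq: "\<And>s t. \<not> prec s t \<Longrightarrow> \<not> prec t s \<Longrightarrow>
        filter (\<lambda>l. l = s \<or> l = t) (x # p) = filter (\<lambda>l. l = s \<or> l = t) (y # q)"
    for x y p q
  proof -
    have "x \<noteq> y" using less ir by auto
    then have "y \<in> set p" using arg_cong[OF eq[OF ir ir, of y], of set] by auto
    then obtain p1 p2 where p: "p = p1 @ y # p2" "y \<notin> set p1" by (metis split_list_first)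
    have "prec s y \<or> prec y s" if s: "s \<in> set p1" for s
    proof (rule ccontr)
      assume "\<not> (prec s y \<or> prec y s)"
      moreover from this have "s \<noteq> x" using less by auto
      ultimately have "filter (\<lambda>l. l = s \<or> l = y) p1 @ y # filter (\<lambda>l. l = s \<or> l = y) p2 =
          y # filter (\<lambda>l. l = s \<or> l = y) q"
        using eq[of s y] \<open>x \<noteq> y\<close> by (simp add: p)
      moreover obtain t ts where "filter (\<lambda>l. l = s \<or> l = y) p1 = t # ts"
        using s by (cases "filter (\<lambda>l. l = s \<or> l = y) p1") (auto simp: filter_empty_conv)
      moreover from this have "t \<in> set p1" by (metis filter_is_subset list.set_intros(1) subsetD)
      ultimately show False using p(2) by auto
    qed
    moreover have "successively (\<lambda>x y. \<not> prec x y) (x # p1)" "\<not> prec (last (x # p1)) y"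
      using desc unfolding p append_Cons[symmetric] successively_append_iff by simp_all
    ultimately show False using successively_comparable_below[OF tr _ less] by blast
  qed
  have lm: "l = m"
  proof (rule ccontr)
    assume "l \<noteq> m"
    have "prec l m \<or> prec m l"
      using Cons.prems(3)[of l m] \<open>l \<noteq> m\<close> by (auto simp: w)
    then show False
      using no[of l m v z] no[of m l z v] Cons.prems unfolding w by metis
  qed
  have "v = z"
  proof (rule Cons.IH)
    show "successively (\<lambda>x y. \<not> prec x y) v" "successively (\<lambda>x y. \<not> prec x y) z"
      using Cons.prems(1,2) by (auto simp: w successively_Cons)
    show "filter (\<lambda>l. l = x \<or> l = y) v = filter (\<lambda>l. l = x \<or> l = y) z"
      if "\<not> prec x y" "\<not> prec y x" for x y
      using Cons.prems(3)[OF that] by (simp add: w lm split: if_splits)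
  qed
  then show ?case by (simp add: w lm)
qed


section \<open>Bicolored Lyndon trees\<close>

lemma leaf_set_simps [simp]:
  "leaf_set (Leaf i) = {i}" "leaf_set (Node c l r) = leaf_set l \<union> leaf_set r"
  by (auto simp: leaf_set_def)

lemma finite_leaf_set [simp]: "finite (leaf_set t)"
  by (simp add: leaf_set_def)

lemma leaf_set_nonempty [simp]: "leaf_set t \<noteq> {}"
  by (induction t) auto

lemma nu_in: "nu t \<in> leaf_set t"
  by (simp add: nu_def)

lemma nu_Leaf [simp]: "nu (Leaf i) = i"
  by (simp add: nu_def)

lemma nu_Node [simp]: "nu (Node c l r) = min (nu l) (nu r)"
  by (simp add: nu_def Min_Un)

fun root_lyndon :: "bit \<Rightarrow> btree \<Rightarrow> btree \<Rightarrow> bool" where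
  "root_lyndon c (Leaf i) r \<longleftrightarrow> True"
| "root_lyndon c (Node d x y) r \<longleftrightarrow> nu r < nu y \<or> c < d"

lemma bicolored_lyndon_tree_Leaf [simp]: "bicolored_lyndon_tree (Leaf i)"
  by (simp add: bicolored_lyndon_tree_def normalized_def is_internal_def)

text \<open>The conditions at a vertex involve only its own children and grandchildren, so they can
  be checked recursively from the root.\<close>

lemma bicolored_lyndon_tree_Node [simp]:
  "bicolored_lyndon_tree (Node c l r) \<longleftrightarrow>
     bicolored_lyndon_tree l \<and> bicolored_lyndon_tree r \<and> nu l \<le> nu r \<and> root_lyndon c l r"
proof -
  have "root_lyndon c l r \<longleftrightarrow>
      (is_internal l \<longrightarrow> lyndon_vertex (Node c l r) \<or> color l > c)"
    by (cases l) (auto simp: is_internal_def lyndon_vertex_def)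
  moreover have "is_internal (Node c l r)" by (simp add: is_internal_def)
  moreover have "nu (Node c l r) = nu l \<longleftrightarrow> nu l \<le> nu r" by auto
  ultimately show ?thesis
    unfolding bicolored_lyndon_tree_def normalized_def subtrees.simps ball_simps(7) ball_Un btree.sel
    by blast
qed

text \<open>Closed form of a merge: the new vertex descends the left branch while its Lyndon and
  color conditions both fail. The test is exactly the negation of
  \<open>root_lyndon u (Node c l r) y\<close>.\<close>

fun insert_vertex :: "bit \<Rightarrow> btree \<Rightarrow> btree \<Rightarrow> btree" where
  "insert_vertex u (Leaf i) y = Node u (Leaf i) y"
| "insert_vertex u (Node c l r) y =
     (if nu r \<le> nu y \<and> c \<le> u then Node c (insert_vertex u l y) r else Node u (Node c l r) y)"

text \<open>The intermediate tree of the sliding process, with the new vertex at depth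
  \<open>k\<close>; it serves as the loop invariant.\<close>

fun insert_at :: "nat \<Rightarrow> bit \<Rightarrow> btree \<Rightarrow> btree \<Rightarrow> btree" where
  "insert_at (Suc k) u (Node c l r) y = Node c (insert_at k u l y) r"
| "insert_at _ u t y = Node u t y"

fun slides :: "bit \<Rightarrow> btree \<Rightarrow> btree \<Rightarrow> nat" where
  "slides u (Leaf i) y = 0"
| "slides u (Node c l r) y = (if nu r \<le> nu y \<and> c \<le> u then Suc (slides u l y) else 0)"

lemma insert_at_slides: "insert_at (slides u t y) u t y = insert_vertex u t y"
  by (induction t) auto

lemma slide_insert_at:
  "k < slides u t y \<Longrightarrow> slide k (insert_at k u t y) = insert_at (Suc k) u t y"
proof (induction t arbitrary: k)
  case (Node c l r)
  then show ?case by (cases k) (auto split: if_splits)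
qed simp

text \<open>Before the last slide the defect sits at the new vertex itself, so the loop cannot stop
  early.\<close>

lemma not_lyndon_insert_at:
  "k < slides u t y \<Longrightarrow> \<not> bicolored_lyndon_tree (insert_at k u t y)"
proof (induction t arbitrary: k)
  case (Node c l r)
  then show ?case by (cases k) (auto split: if_splits)
qed simp

lemma leaf_set_insert_vertex [simp]: "leaf_set (insert_vertex u t y) = leaf_set t \<union> leaf_set y"
  by (induction t) auto

lemma nu_insert_vertex [simp]: "nu (insert_vertex u t y) = min (nu t) (nu y)"
  by (simp add: nu_def Min_Un)

lemma mset_leaf_list_insert_vertex:
  "mset (leaf_list (insert_vertex u t y)) = mset (leaf_list t) + mset (leaf_list y)"
  by (induction t) auto

lemma nu_neq: "disjnt (leaf_set s) (leaf_set t) \<Longrightarrow> nu s \<noteq> nu t"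
  using nu_in[of s] nu_in[of t] by (auto simp: disjnt_iff)

text \<open>The left child is either the new vertex, whose right subtree \<open>y\<close> has larger
  minimum than \<open>r\<close>, or the old vertex with its color and right subtree intact.\<close>

lemma root_lyndon_insert_vertex:
  assumes "root_lyndon c l r" "nu r < nu y"
  shows "root_lyndon c (insert_vertex u l y) r"
  using assms by (cases l) auto

lemma lyndon_insert_vertex:
  "bicolored_lyndon_tree t \<Longrightarrow> bicolored_lyndon_tree y \<Longrightarrow> disjnt (leaf_set t) (leaf_set y) \<Longrightarrow>
    nu t < nu y \<Longrightarrow> bicolored_lyndon_tree (insert_vertex u t y)"
proof (induction t)
  case (Node c l r)
  have "nu r \<noteq> nu y" using Node.prems(3) by (intro nu_neq) (auto simp: disjnt_Un1)
  then show ?case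
    using Node by (auto simp: disjnt_Un1 root_lyndon_insert_vertex)
qed simp

definition lyndon :: "btree \<Rightarrow> bool" where
  "lyndon t \<longleftrightarrow> distinct (leaf_list t) \<and> bicolored_lyndon_tree t"

text \<open>The loop runs exactly \<open>slides u t y\<close> times: all earlier trees fail the
  Lyndon test, and the last one passes it by \<open>lyndon_insert_vertex\<close>.\<close>

lemma merge_trees_eq:
  assumes "separated lyndon leaf_set t y"
  shows "merge_trees u t y = insert_vertex u t y"
proof -
  have lyn: "bicolored_lyndon_tree (insert_vertex u t y)"
    using assms by (intro lyndon_insert_vertex) (auto simp: separated_def lyndon_def nu_def)
  let ?b = "\<lambda>(k :: nat, t). \<not> bicolored_lyndon_tree t" and ?c = "\<lambda>(k, t). (Suc k, slide k t)"
  have "snd (while ?b ?c (0, Node u t y)) = insert_vertex u t y"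
  proof (rule while_rule[where P = "\<lambda>(k, z). k \<le> slides u t y \<and> z = insert_at k u t y"
        and r = "Wellfounded.measure (\<lambda>(k, z). slides u t y - k)"])
    show "case (0, Node u t y) of (k, z) \<Rightarrow> k \<le> slides u t y \<and> z = insert_at k u t y"
      by simp
    fix s :: "nat \<times> btree"
    obtain k z where s: "s = (k, z)" by (cases s)
    assume P: "case s of (k, z) \<Rightarrow> k \<le> slides u t y \<and> z = insert_at k u t y"
    {
      assume "?b s"
      then have "k < slides u t y"
        using P lyn by (auto simp: s le_less insert_at_slides)
      then show "case ?c s of (k, z) \<Rightarrow> k \<le> slides u t y \<and> z = insert_at k u t y"
        "(?c s, s) \<in> Wellfounded.measure (\<lambda>(k, z). slides u t y - k)"
        using P by (auto simp: s slide_insert_at)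
    }
    assume "\<not> ?b s"
    then have "\<not> k < slides u t y" using P not_lyndon_insert_at by (auto simp: s)
    then show "snd s = insert_vertex u t y" using P by (auto simp: s le_less insert_at_slides)
  qed simp
  then show ?thesis by (simp add: merge_trees_def)
qed

lemma lyndon_merge_trees:
  assumes "separated lyndon leaf_set t y"
  shows "lyndon (merge_trees u t y)"
proof -
  have "bicolored_lyndon_tree (insert_vertex u t y)"
    using assms by (intro lyndon_insert_vertex) (auto simp: separated_def lyndon_def nu_def)
  moreover have "distinct (leaf_list (insert_vertex u t y)) \<longleftrightarrow> distinct (leaf_list t @ leaf_list y)"
    by (rule mset_eq_imp_distinct_iff) (simp add: mset_leaf_list_insert_vertex)
  ultimately show ?thesis
    using assms by (auto simp: merge_trees_eq lyndon_def separated_def leaf_set_def disjnt_def)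
qed

text \<open>The vertex carrying \<open>z\<close> slides past every vertex that the one carrying
  \<open>y\<close> passes, and past that vertex too, but never conversely. So each finds the same
  place in either order.\<close>

lemma insert_vertex_commute:
  "nu y < nu z \<Longrightarrow> u \<le> v \<Longrightarrow>
    insert_vertex v (insert_vertex u t y) z = insert_vertex u (insert_vertex v t z) y"
  by (induction t) auto

text \<open>Each vertex carries the label of the merge that creates it. The preorder lists parents
  before children, so late merges tend to come first.\<close>

fun vertex_labels :: "btree \<Rightarrow> label list" where
  "vertex_labels (Leaf i) = []"
| "vertex_labels (Node c l r) = (nu l, nu r, c) # vertex_labels l @ vertex_labels r"

lemma vertex_labels_fst: "l \<in> set (vertex_labels t) \<Longrightarrow> fst l \<in> leaf_set t"
  by (induction t) (auto simp: nu_in)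

text \<open>The number of vertices of color 1 reveals the color of the new vertex.\<close>

lemma insert_vertex_inject:
  assumes "insert_vertex u t y = insert_vertex v t y"
  shows "u = v"
proof -
  have "length (filter (\<lambda>l. snd (snd l)) (vertex_labels (insert_vertex w t y))) = of_bool w +
      length (filter (\<lambda>l. snd (snd l)) (vertex_labels t)) +
      length (filter (\<lambda>l. snd (snd l)) (vertex_labels y))" for w
    by (induction t) auto
  from this[of u] this[of v] assms show ?thesis by (cases u; cases v) auto
qed

lemma separated_insert_vertex:
  assumes "separated lyndon leaf_set x y" "separated lyndon leaf_set x z" "separated lyndon leaf_set y z"
  shows "separated lyndon leaf_set (insert_vertex u x y) z"
  using assms lyndon_merge_trees[OF assms(1), of u] merge_trees_eq[OF assms(1), of u]
  by (auto simp: separated_def disjnt_Un1 Min_Un)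

lemma separated_sym_insert_vertex:
  assumes "separated lyndon leaf_set x y" "separated lyndon leaf_set x z" "separated lyndon leaf_set y z"
  shows "separated lyndon leaf_set (insert_vertex u x z) y"
  using assms lyndon_merge_trees[OF assms(2), of u] merge_trees_eq[OF assms(2), of u]
  by (auto simp: separated_def disjnt_Un1 disjnt_sym Min_Un)

text \<open>A Lyndon tree is the merge of its two branches without any slide.\<close>

lemma lyndon_Node:
  assumes "lyndon (Node c l r)"
  shows "separated lyndon leaf_set l r" "merge_trees c l r = Node c l r"
proof -
  have d: "disjnt (leaf_set l) (leaf_set r)"
    using assms by (simp add: lyndon_def leaf_set_def disjnt_def)
  show s: "separated lyndon leaf_set l r"
    using assms d nu_neq[OF d] by (simp add: separated_def lyndon_def nu_def[symmetric])
  have "root_lyndon c l r" using assms by (simp add: lyndon_def)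
  then show "merge_trees c l r = Node c l r"
    unfolding merge_trees_eq[OF s] by (cases l) auto
qed

section \<open>Forests as a merge system, and recovering words from them\<close>

interpretation fl: merge_system lyndon leaf_set merge_trees Leaf n for n
proof
  fix X Y Z :: btree and u v :: bit
  show "finite (leaf_set X)" "leaf_set X \<noteq> {}" by simp_all
  show "lyndon (Leaf i)" "leaf_set (Leaf i) = {i}" for i by (simp_all add: lyndon_def)
  show "(\<exists>i. X = Leaf i) \<or> (\<exists>u Y Z. separated lyndon leaf_set Y Z \<and> X = merge_trees u Y Z)"
    if "lyndon X" using that lyndon_Node by (cases X) metis+
  assume XY: "separated lyndon leaf_set X Y"
  show "leaf_set (merge_trees u X Y) = leaf_set X \<union> leaf_set Y" by (simp add: merge_trees_eq[OF XY])
  show "lyndon (merge_trees u X Y)" by (rule lyndon_merge_trees[OF XY])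
  show "u = v" if "merge_trees u X Y = merge_trees v X Y"
    using that insert_vertex_inject by (simp add: merge_trees_eq[OF XY])
  assume XZ: "separated lyndon leaf_set X Z" and YZ: "separated lyndon leaf_set Y Z" and "u \<le> v"
  have "nu Y < nu Z" using YZ by (simp add: separated_def nu_def)
  then show "merge_trees v (merge_trees u X Y) Z = merge_trees u (merge_trees v X Z) Y"
    using insert_vertex_commute[of Y Z u v X] \<open>u \<le> v\<close>
      separated_insert_vertex[OF XY XZ YZ] separated_sym_insert_vertex[OF XY XZ YZ]
    by (simp add: merge_trees_eq XY XZ)
qed

lemma confs_fl: "fl.confs n = bicolored_lyndon_forests n"
  by (auto simp: fl.confs_def bicolored_lyndon_forests_def lyndon_def)

lemma FLyn_w_ord: "FLyn_w n = fl.ord n"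
  unfolding FLyn_w_def confs_fl[symmetric]
  by (rule generated_order_cong) (auto simp: fl.step_iff forest_step_def nu_def)

text \<open>Sliding changes the preorder, but only the relative order of labels that cannot both
  satisfy \<open>P\<close>. Hence the new label may be treated as if it had stayed at the
  root.\<close>

lemma filter_insert_vertex:
  assumes P: "\<And>l. P l \<Longrightarrow> fst l = a" and inc: "\<And>l l'. P l \<Longrightarrow> P l' \<Longrightarrow> \<not> label_less l l'"
  shows "bicolored_lyndon_tree t \<Longrightarrow> disjnt (leaf_set t) (leaf_set y) \<Longrightarrow> nu t < nu y \<Longrightarrow>
    filter P (vertex_labels (insert_vertex u t y)) =
    filter P ((nu t, nu y, u) # vertex_labels t @ vertex_labels y)"
proof (induction t)
  case (Node c l r)
  show ?case
  proof (cases "nu r \<le> nu y \<and> c \<le> u")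
    case True
    have le: "nu l \<le> nu r" "nu l < nu y" using Node.prems by auto
    have d: "disjnt (leaf_set l) (leaf_set y)" "disjnt (leaf_set r) (leaf_set y)"
      using Node.prems(2) by (auto simp: disjnt_Un1)
    have IH: "filter P (vertex_labels (insert_vertex u l y)) =
        filter P [(nu l, nu y, u)] @ filter P (vertex_labels l) @ filter P (vertex_labels y)"
      using Node.IH(1)[OF _ d(1) le(2)] Node.prems(1) by simp
    \<comment> \<open>The vertex passed in a slide and the new vertex have comparable
      labels.\<close>
    have "label_less (nu l, nu r, c) (nu l, nu y, u)" using True nu_neq[OF d(2)] by simp
    then have "\<not> P (nu l, nu r, c) \<or> \<not> P (nu l, nu y, u)" using inc by blast
    \<comment> \<open>The slide also moves \<open>y\<close> in front of \<open>r\<close>; their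
      labels have first entries in disjoint leaf sets, so at most one side meets
      \<open>P\<close>.\<close>
    moreover have "filter P (vertex_labels y) = [] \<or> filter P (vertex_labels r) = []"
    proof (rule ccontr)
      assume "\<not> ?thesis"
      then obtain k k' where "k \<in> set (vertex_labels y)" "P k" "k' \<in> set (vertex_labels r)" "P k'"
        by (auto simp: filter_empty_conv)
      then have "a \<in> leaf_set y" "a \<in> leaf_set r"
        using vertex_labels_fst[of k y] vertex_labels_fst[of k' r] P by auto
      then show False using d(2) by (auto simp: disjnt_iff)
    qed
    ultimately show ?thesis using True IH le by auto
  qed auto
qed simp

lemma filter_merge:
  assumes P: "\<And>l. P l \<Longrightarrow> fst l = a" and inc: "\<And>l l'. P l \<Longrightarrow> P l' \<Longrightarrow> \<not> label_less l l'"
    and S: "S \<in> fl.confs n" and l: "l \<in> fl.enabled S" and a: "a \<in> {1..n}"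
  shows "filter P (vertex_labels (fl.blk (fl.merge S l) a)) =
    filter P [l] @ filter P (vertex_labels (fl.blk S a))"
proof -
  obtain c d u where [simp]: "l = (c, d, u)" by (cases l)
  note e = fl.enabledD[OF S l[simplified]]
  let ?t = "fl.blk S c" and ?y = "fl.blk S d"
  have nu: "nu ?t = c" "nu ?y = d" using e(9,10) by (simp_all add: nu_def)
  have eq: "filter P (vertex_labels (merge_trees u ?t ?y)) =
      filter P [l] @ filter P (vertex_labels ?t) @ filter P (vertex_labels ?y)"
    unfolding merge_trees_eq[OF e(11)]
    using filter_insert_vertex[of P a ?t ?y u, OF P inc] e(11) nu
    by (simp add: separated_def lyndon_def nu_def[symmetric])
  have blk: "fl.blk (fl.merge S l) a =
      (if fl.root S a = c \<or> fl.root S a = d then merge_trees u ?t ?y else fl.blk S a)"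
    using fl.blk_merge[OF S l[simplified] a] by simp
  have Pl: "fl.root S a = c" if "P l" using P[OF that] e(4) by simp
  have empty: "filter P (vertex_labels x) = []" if "x \<in> S" "fl.blk S a \<noteq> x" for x
  proof -
    have "a \<notin> leaf_set x" using fl.blk_eq[OF S that(1)] that(2) by blast
    then show ?thesis using vertex_labels_fst P by (fastforce simp: filter_empty_conv)
  qed
  have iff: "fl.blk S a = ?t \<longleftrightarrow> fl.root S a = c" "fl.blk S a = ?y \<longleftrightarrow> fl.root S a = d"
    using fl.blk_eq_iff[OF S a e(1)] fl.blk_eq_iff[OF S a e(2)] e(4,5) by auto
  consider "fl.root S a = c" | "fl.root S a = d" "fl.root S a \<noteq> c"
    | "fl.root S a \<noteq> c" "fl.root S a \<noteq> d" by blast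
  then show ?thesis
  proof cases
    case 1
    then have "fl.blk S a = ?t" using iff by blast
    then show ?thesis using 1 blk eq empty[OF e(7)] e(8) by simp
  next
    case 2
    then have "fl.blk S a = ?y" using iff by blast
    then show ?thesis using 2 blk eq empty[OF e(6)] e(8) Pl by auto
  next
    case 3
    then show ?thesis using blk Pl by auto
  qed
qed

text \<open>Every merge puts its label in front, so the projection of the word appears in the final
  tree backwards.\<close>

lemma filter_exec:
  assumes P: "\<And>l. P l \<Longrightarrow> fst l = a" and inc: "\<And>l l'. P l \<Longrightarrow> P l' \<Longrightarrow> \<not> label_less l l'"
    and a: "a \<in> {1..n}"
  shows "S \<in> fl.confs n \<Longrightarrow> fl.path S w \<Longrightarrow>
    filter P (vertex_labels (fl.blk (fl.exec S w) a)) = rev (filter P w) @ filter P (vertex_labels (fl.blk S a))"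
proof (induction w arbitrary: S)
  case (Cons l w)
  then have "fl.merge S l \<in> fl.confs n" "l \<in> fl.enabled S" "fl.path (fl.merge S l) w"
    using fl.act_in by auto
  then show ?case
    using Cons.IH[of "fl.merge S l"] filter_merge[of P a S n l, OF P inc Cons.prems(1) _ a] by simp
qed simp

text \<open>Swapping an ascent moves the larger label to the left; complementing the entries turns
  this growth into descent in a well-founded order.\<close>

definition swap_rel :: "nat \<Rightarrow> label rel" where
  "swap_rel n = inv_image (less_than <*lex*> less_than <*lex*> less_than)
     (\<lambda>(a, b, u). (n - a, n - b, 1 - of_bool u))"

lemma wf_swap_rel: "wf (swap_rel n)"
  unfolding swap_rel_def by (intro wf_inv_image wf_lex_prod wf_less_than)

lemma swap_rel:
  assumes "label_less l l'" "fst l' \<le> n" "fst (snd l') \<le> n"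
  shows "(l', l) \<in> swap_rel n"
proof -
  obtain a b u c d v where [simp]: "l = (a, b, u)" "l' = (c, d, v)" by (cases l, cases l')
  show ?thesis using assms by (cases u; cases v) (auto simp: swap_rel_def le_less)
qed

text \<open>Existence follows by swapping ascents. For uniqueness, two incomparable labels share
  their first entry, so \<open>filter_exec\<close> reads their projection off a single block, and
  \<open>ascent_free_eq\<close> rebuilds the word.\<close>

theorem unique_paths_fl: "fl.unique_paths n (\<lambda>l l'. \<not> label_less l l')"
  unfolding fl.unique_paths_def
proof (intro ballI allI impI)
  fix S w assume S: "S \<in> fl.confs n" "fl.path S w"
  have "\<exists>v. fl.path S v \<and> fl.exec S v = fl.exec S w \<and> successively (\<lambda>l l'. \<not> label_less l l') v"
  proof (rule fl.exists_successively[OF wf_swap_rel[of n] _ S])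
    fix S l l'
    assume h: "S \<in> fl.confs n" "l \<in> fl.enabled S" "l' \<in> fl.enabled (fl.merge S l)"
      "\<not> \<not> label_less l l'"
    then have "label_less l l'" by blast
    note sw = fl.ascent_swap[OF h(1-3) this]
    have "fst l' \<le> n" "fst (snd l') \<le> n" using fl.en_subset[OF h(1)] sw(1) by auto
    then have "(l', l) \<in> swap_rel n" using h(4) swap_rel by blast
    then show "\<exists>m m'. m \<in> fl.enabled S \<and> m' \<in> fl.enabled (fl.merge S m) \<and>
        fl.merge (fl.merge S m) m' = fl.merge (fl.merge S l) l' \<and> (m, l) \<in> swap_rel n"
      using sw by blast
  qed
  moreover have "v = z"
    if v: "fl.path S v" "fl.exec S v = fl.exec S w" "successively (\<lambda>l l'. \<not> label_less l l') v"
      and z: "fl.path S z" "fl.exec S z = fl.exec S w" "successively (\<lambda>l l'. \<not> label_less l l') z"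
    for v z
  proof (rule ascent_free_eq[OF transp_label_less asymp_label_less v(3) z(3)])
    fix x y assume xy: "\<not> label_less x y" "\<not> label_less y x"
    have fst: "fst x = fst y" using xy by (cases x; cases y) auto
    let ?P = "\<lambda>l. l = x \<or> l = y"
    have P: "fst l = fst x" if "?P l" for l using that fst by auto
    have inc: "\<not> label_less l l'" if "?P l" "?P l'" for l l'
      using that xy asymp_label_less by blast
    show "filter ?P v = filter ?P z"
    proof (cases "fst x \<in> {1..n}")
      case True
      then show ?thesis
        using filter_exec[of ?P "fst x" n S v, OF P inc True S(1) v(1)] filter_exec[of ?P "fst x" n S z, OF P inc True S(1) z(1)] v(2) z(2)
        by simp
    next
      case False
      have "filter ?P p = []" if "fl.path S p" for p
      proof -
        have "fst l \<in> {1..n}" if "l \<in> set p" for l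
          using fl.path_labels[OF S(1) \<open>fl.path S p\<close>] that by (cases l) auto
        then show ?thesis using False P unfolding filter_empty_conv by metis
      qed
      then show ?thesis using v(1) z(1) by simp
    qed
  qed
  ultimately show "\<exists>!v. fl.path S v \<and> fl.exec S v = fl.exec S w \<and>
      successively (\<lambda>l l'. \<not> label_less l l') v"
    by (rule ex_ex1I) simp_all
qed

section \<open>The poset of ascent-free chains\<close>

lemma (in merge_system) path_swap:
  assumes S: "S \<in> confs" and w: "path S (p @ [l, l'] @ q)" and lt: "label_less l l'"
  shows "path S (p @ [l', l] @ q)" "exec S (p @ [l', l] @ q) = exec S (p @ [l, l'] @ q)"
proof -
  have h: "exec S p \<in> confs" "l \<in> enabled (exec S p)" "l' \<in> enabled (merge (exec S p) l)"
    using w S exec_in by (auto simp: path_append)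
  note sw = ascent_swap[OF h lt]
  show "path S (p @ [l', l] @ q)" "exec S (p @ [l', l] @ q) = exec S (p @ [l, l'] @ q)"
    using w sw by (auto simp: path_append)
qed

lemma less_in_Lambda_w:
  assumes "1 \<le> a" "a < b" "b \<le> n" "1 \<le> c" "c < d" "d \<le> n"
  shows "less_in (Lambda_w n) (a, b, u) (c, d, v) \<longleftrightarrow> label_less (a, b, u) (c, d, v)"
proof -
  have F: "(b, x, t) \<in> Field (Gamma_w n a) \<longleftrightarrow> b = a \<and> a < x \<and> x \<le> n" for a b x t
  proof
    assume "b = a \<and> a < x \<and> x \<le> n"
    then have "((b, x, t), (b, x, t)) \<in> Gamma_w n a" by (auto simp: Gamma_w_def)
    then show "(b, x, t) \<in> Field (Gamma_w n a)" by (rule FieldI1)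
  qed (auto simp: Field_def Gamma_w_def)
  have "((a, b, u), (c, d, v)) \<in> Lambda_w n \<longleftrightarrow> a = c \<and> b \<le> d \<and> u \<le> v \<or> a < c"
    using assms by (auto simp: Lambda_w_def ordinal_sum_def F) (auto simp: Gamma_w_def)
  then show ?thesis by (auto simp: less_in_def)
qed

lemma ascent_at_iff:
  assumes "merge_word {1..n} w"
  shows "ascent_at (Lambda_w n) w i \<longleftrightarrow> Suc i < length w \<and> label_less (w ! i) (w ! Suc i)"
proof -
  have "1 \<le> a \<and> a < b \<and> b \<le> n" if "(a, b, u) \<in> set w" for a b u
    using wp.path_label[OF wp.bottom_in _ that] assms unfolding wp.path_bottom wp.mins_bottom by auto
  then have "less_in (Lambda_w n) l l' \<longleftrightarrow> label_less l l'" if "l \<in> set w" "l' \<in> set w" for l l'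
    using that by (cases l; cases l') (metis less_in_Lambda_w)
  then show ?thesis by (metis Suc_lessD ascent_at_def nth_mem)
qed

lemma ascent_free_iff:
  assumes "merge_word {1..n} w"
  shows "ascent_free (Lambda_w n) w \<longleftrightarrow> successively (\<lambda>l l'. \<not> label_less l l') w"
  using ascent_at_iff[OF assms] by (auto simp: ascent_free_def successively_conv_nth)

lemma swap_first_ascent:
  assumes w: "merge_word {1..n} w" and "\<not> ascent_free (Lambda_w n) w"
  shows "\<exists>p l l' q. w = p @ [l, l'] @ q \<and> swap_first_ascent (Lambda_w n) w = p @ [l', l] @ q \<and>
    label_less l l'"
proof -
  define i where "i = (LEAST i. ascent_at (Lambda_w n) w i)"
  have "ascent_at (Lambda_w n) w i"
    using assms(2) unfolding i_def ascent_free_def by (auto intro: LeastI)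
  then have i: "Suc i < length w" "label_less (w ! i) (w ! Suc i)"
    using ascent_at_iff[OF w] by auto
  define p q where "p = take i w" and "q = drop (Suc (Suc i)) w"
  have eq: "w = p @ [w ! i, w ! Suc i] @ q"
    using i unfolding p_def q_def
    by (metis Cons_nth_drop_Suc Suc_lessD append_Cons append_Nil append_take_drop_id)
  have len: "length p = i" using i by (simp add: p_def)
  have "swap_first_ascent (Lambda_w n) w = w[i := w ! Suc i, Suc i := w ! i]"
    by (simp add: swap_first_ascent_def i_def Let_def)
  also have "\<dots> = (p @ [w ! i, w ! Suc i] @ q)[i := w ! Suc i, Suc i := w ! i]"
    using eq by simp
  also have "\<dots> = p @ [w ! Suc i, w ! i] @ q"
    using len by (simp add: list_update_append)
  finally show ?thesis using eq i(2) by blast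
qed

text \<open>Invariance under one swap of an ascent holds in every merge system, so sorting keeps
  both the partition and the forest reached. It terminates because larger labels move left.\<close>

lemma sort_word:
  assumes w: "merge_word {1..n} w"
  defines "s \<equiv> sort_word (Lambda_w n) w"
  shows "merge_word {1..n} s" "successively (\<lambda>l l'. \<not> label_less l l') s"
    "wp.exec (wp.bottom n) s = wp.exec (wp.bottom n) w"
    "fl.exec (fl.bottom n) s = fl.exec (fl.bottom n) w"
proof -
  let ?P = "\<lambda>v. merge_word {1..n} v \<and> wp.exec (wp.bottom n) v = wp.exec (wp.bottom n) w \<and>
    fl.exec (fl.bottom n) v = fl.exec (fl.bottom n) w"
  have "?P s \<and> ascent_free (Lambda_w n) s"
    unfolding s_def sort_word_def
  proof (rule while_rule[where P = ?P and r = "lex (swap_rel n)"])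
    show "wf (lex (swap_rel n))" by (intro wf_lex wf_swap_rel)
    fix v
    assume P: "?P v"
    {
      assume "\<not> ascent_free (Lambda_w n) v"
      then obtain p l l' q where v: "v = p @ [l, l'] @ q" "label_less l l'"
        "swap_first_ascent (Lambda_w n) v = p @ [l', l] @ q"
        using swap_first_ascent P by blast
      have wp: "wp.path (wp.bottom n) (p @ [l, l'] @ q)" and fl: "fl.path (fl.bottom n) (p @ [l, l'] @ q)"
        using P unfolding v(1) wp.path_bottom fl.path_bottom by blast+
      show "?P (swap_first_ascent (Lambda_w n) v)"
        using P wp.path_swap[OF wp.bottom_in wp v(2)] fl.path_swap[OF fl.bottom_in fl v(2)]
        unfolding v(3) wp.path_bottom unfolding v(1) by metis
      have "set v \<subseteq> {1..n} \<times> {1..n} \<times> UNIV"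
        unfolding v(1) using wp.path_labels[OF wp.bottom_in wp] .
      then have "(l', l) \<in> swap_rel n" by (intro swap_rel[OF v(2)]) (auto simp: v(1))
      then show "(swap_first_ascent (Lambda_w n) v, v) \<in> lex (swap_rel n)"
        unfolding v(3) unfolding v(1) by (rule lex_replace)
    }
    show "?P v \<and> ascent_free (Lambda_w n) v" if "\<not> \<not> ascent_free (Lambda_w n) v"
      using P that by blast
  qed (use w in simp)
  then show "merge_word {1..n} s" "successively (\<lambda>l l'. \<not> label_less l l') s"
    "wp.exec (wp.bottom n) s = wp.exec (wp.bottom n) w"
    "fl.exec (fl.bottom n) s = fl.exec (fl.bottom n) w"
    using ascent_free_iff by blast+
qed

text \<open>Labels determine the steps, so a chain from the bottom is recovered from its label
  word.\<close>

lemma R_elements_Pi_w: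
  "R_elements (Lambda_w n) lambda_w (Pi_w n) =
    (\<lambda>w. (wp.exec (wp.bottom n) w, w)) `
      {w. merge_word {1..n} w \<and> successively (\<lambda>l l'. \<not> label_less l l') w}"
proof -
  have "chain_labels lambda_w (wp.states (wp.bottom n) w) = w" if "wp.path (wp.bottom n) w" for w
    by (rule wp.chain_labels_states[OF lambda_w_merge wp.bottom_in that])
  then have "R_elements (Lambda_w n) lambda_w (Pi_w n) =
      {(x, w). wp.path (wp.bottom n) w \<and> wp.exec (wp.bottom n) w = x \<and> ascent_free (Lambda_w n) w}"
    using wp.bottom_in unfolding R_elements_def Pi_w_ord wp.zero_hat_ord wp.saturated_chain_iff
    by (auto; metis)
  then show ?thesis unfolding wp.path_bottom using ascent_free_iff by auto
qed

section \<open>The isomorphism between forests and ascent-free chains\<close>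

definition forest_word :: "nat \<Rightarrow> btree set \<Rightarrow> label list" where
  "forest_word n F = (THE w. fl.path (fl.bottom n) w \<and> fl.exec (fl.bottom n) w = F \<and>
     successively (\<lambda>l l'. \<not> label_less l l') w)"

lemma forest_word_eq:
  assumes "merge_word {1..n} w" "successively (\<lambda>l l'. \<not> label_less l l') w"
  shows "forest_word n (fl.exec (fl.bottom n) w) = w"
  unfolding forest_word_def
proof (rule the1_equality)
  have w: "fl.path (fl.bottom n) w" using assms by (simp only: fl.path_bottom)
  show "\<exists>!v. fl.path (fl.bottom n) v \<and> fl.exec (fl.bottom n) v = fl.exec (fl.bottom n) w \<and>
      successively (\<lambda>l l'. \<not> label_less l l') v"
    using unique_paths_fl[of n] fl.bottom_in w unfolding fl.unique_paths_def by blast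
qed (use assms fl.path_bottom in blast)

lemma forest_word:
  assumes "F \<in> fl.confs n"
  shows "merge_word {1..n} (forest_word n F)" "successively (\<lambda>l l'. \<not> label_less l l') (forest_word n F)"
    "fl.exec (fl.bottom n) (forest_word n F) = F"
proof -
  obtain w where "fl.path (fl.bottom n) w" "fl.exec (fl.bottom n) w = F"
    using fl.reachable[OF assms] by blast
  then obtain v where v: "merge_word {1..n} v" "fl.exec (fl.bottom n) v = F"
    "successively (\<lambda>l l'. \<not> label_less l l') v"
    using unique_paths_fl[of n] fl.bottom_in unfolding fl.unique_paths_def fl.path_bottom[symmetric] by blast
  then have "forest_word n F = v" using forest_word_eq by blast
  with v show "merge_word {1..n} (forest_word n F)"
    "successively (\<lambda>l l'. \<not> label_less l l') (forest_word n F)"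
    "fl.exec (fl.bottom n) (forest_word n F) = F" by auto
qed

definition forest_chain :: "nat \<Rightarrow> btree set \<Rightarrow> weighted_set set \<times> label list" where
  "forest_chain n F = (wp.exec (wp.bottom n) (forest_word n F), forest_word n F)"

lemma bij_forest_chain:
  "bij_betw (forest_chain n) (fl.confs n) (R_elements (Lambda_w n) lambda_w (Pi_w n))"
  unfolding R_elements_Pi_w
proof (rule bij_betw_byWitness[where f' = "\<lambda>(x, w). fl.exec (fl.bottom n) w"])
  show "\<forall>F\<in>fl.confs n. (case forest_chain n F of (x, w) \<Rightarrow> fl.exec (fl.bottom n) w) = F"
    by (simp add: forest_chain_def forest_word del: One_nat_def)
  show "(\<lambda>(x, w). fl.exec (fl.bottom n) w) ` (\<lambda>w. (wp.exec (wp.bottom n) w, w)) `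
      {w. merge_word {1..n} w \<and> successively (\<lambda>l l'. \<not> label_less l l') w} \<subseteq> fl.confs n"
    using fl.exec_in[OF fl.bottom_in] by (auto simp: fl.path_bottom simp del: One_nat_def)
qed (auto simp: forest_chain_def forest_word forest_word_eq simp del: One_nat_def)

lemma forest_chain_step:
  assumes F: "F \<in> fl.confs n" and F': "F' \<in> fl.confs n"
  shows "fl.step F F' \<longleftrightarrow>
    R_step (Lambda_w n) lambda_w (Pi_w n) (forest_chain n F) (forest_chain n F')"
proof -
  define w where "w = forest_word n F"
  define x where "x = wp.exec (wp.bottom n) w"
  note w = forest_word[OF F, folded w_def]
  have x: "x \<in> wp.confs n"
    unfolding x_def using w(1) wp.exec_in[OF wp.bottom_in] by (simp only: wp.path_bottom)
  have snoc: "l \<in> fl.enabled F \<longleftrightarrow> merge_word {1..n} (w @ [l])"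
    "l \<in> wp.enabled x \<longleftrightarrow> merge_word {1..n} (w @ [l])" for l
    using w(1,3) fl.path_append[of "fl.bottom n" w "[l]"] wp.path_append[of "wp.bottom n" w "[l]"]
    unfolding fl.path_bottom wp.path_bottom x_def by simp_all
  \<comment> \<open>The sorted word is ascent-free and still leads to \<open>fl.merge F l\<close>;
    by uniqueness it is the word of that forest.\<close>
  have key: "F' = fl.merge F l \<longleftrightarrow>
      wp.exec (wp.bottom n) (forest_word n F') = wp.merge x l \<and>
      forest_word n F' = sort_word (Lambda_w n) (w @ [l])"
    if l: "merge_word {1..n} (w @ [l])" for l
  proof -
    note s = sort_word[OF l]
    have fs: "fl.exec (fl.bottom n) (sort_word (Lambda_w n) (w @ [l])) = fl.merge F l"
      using s(4) w(3) by simp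
    have ws: "wp.exec (wp.bottom n) (sort_word (Lambda_w n) (w @ [l])) = wp.merge x l"
      using s(3) by (simp add: x_def)
    show ?thesis
      using forest_word_eq[OF s(1,2)] forest_word(3)[OF F'] unfolding fs by (metis fs ws)
  qed
  have "R_step (Lambda_w n) lambda_w (Pi_w n) (forest_chain n F) (forest_chain n F') \<longleftrightarrow>
    (\<exists>l. merge_word {1..n} (w @ [l]) \<and> wp.exec (wp.bottom n) (forest_word n F') = wp.merge x l \<and>
      forest_word n F' = sort_word (Lambda_w n) (w @ [lambda_w x (wp.merge x l)]))"
    using x unfolding R_step_def forest_chain_def w_def[symmetric] x_def[symmetric] prod.case
      Pi_w_ord wp.covered_by_iff wp.step_def Bex_def snoc(2)
    by metis
  also have "\<dots> \<longleftrightarrow> (\<exists>l. merge_word {1..n} (w @ [l]) \<and> F' = fl.merge F l)"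
    using key lambda_w_merge[OF x] snoc(2) by metis
  also have "\<dots> \<longleftrightarrow> fl.step F F'" unfolding fl.step_def snoc(1)[symmetric] by blast
  finally show ?thesis by simp
qed

lemma generated_order_map:
  assumes f: "\<And>x. x \<in> C \<Longrightarrow> f x \<in> D"
    and st: "\<And>x y. x \<in> C \<Longrightarrow> y \<in> C \<Longrightarrow> s x y \<Longrightarrow> t (f x) (f y)"
    and xy: "(x, y) \<in> generated_order C s"
  shows "(f x, f y) \<in> generated_order D t"
proof -
  have "x \<in> C" "y \<in> C" and "(x, y) \<in> {(a, b). a \<in> C \<and> b \<in> C \<and> s a b}\<^sup>*"
    using xy by (auto simp: generated_order_def)
  from this(3) have "(f x, f y) \<in> {(a, b). a \<in> D \<and> b \<in> D \<and> t a b}\<^sup>*"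
  proof (induction rule: rtrancl_induct)
    case (step y z)
    then have "(f y, f z) \<in> {(a, b). a \<in> D \<and> b \<in> D \<and> t a b}" using f st by blast
    with step.IH show ?case by (rule rtrancl_into_rtrancl)
  qed simp
  then show ?thesis using \<open>x \<in> C\<close> \<open>y \<in> C\<close> f by (simp add: generated_order_def)
qed

lemma Field_generated_order: "Field (generated_order C s) = C"
  by (auto simp: Field_def generated_order_def)

lemma poset_isomorphic_generated_order:
  assumes bij: "bij_betw f C D"
    and st: "\<And>x y. x \<in> C \<Longrightarrow> y \<in> C \<Longrightarrow> s x y \<longleftrightarrow> t (f x) (f y)"
  shows "poset_isomorphic (generated_order C s) (generated_order D t)"
  unfolding poset_isomorphic_def Field_generated_order
proof (intro exI[of _ f] conjI ballI bij)
  fix x y assume xy: "x \<in> C" "y \<in> C"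
  let ?g = "inv_into C f"
  have g: "?g z \<in> C" "f (?g z) = z" if "z \<in> D" for z
    using that bij by (auto simp: bij_betw_def inv_into_into f_inv_into_f)
  have gf: "?g (f z) = z" if "z \<in> C" for z
    using that bij by (auto simp: bij_betw_def)
  have "(?g (f x), ?g (f y)) \<in> generated_order C s" if "(f x, f y) \<in> generated_order D t"
    by (rule generated_order_map[OF _ _ that]) (use g st in auto)
  moreover have "(f x, f y) \<in> generated_order D t" if "(x, y) \<in> generated_order C s"
    by (rule generated_order_map[OF _ _ that]) (use st bij in \<open>auto simp: bij_betw_def\<close>)
  ultimately show "(x, y) \<in> generated_order C s \<longleftrightarrow> (f x, f y) \<in> generated_order D t"
    using gf xy by auto
qed

theorem theorem3p10:
  fixes n :: nat
  assumes "n \<ge> 1"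
  shows "whitney_duals (Pi_w n) (FLyn_w n) \<and>
         poset_isomorphic (FLyn_w n) (R_poset (Lambda_w n) lambda_w (Pi_w n))"
proof
  \<comment> \<open>After rewriting, each first Whitney number is a sign times the count of the same
    words as the second Whitney number of the other poset: ascent-free words in one equation,
    ascending words in the other.\<close>
  show "whitney_duals (Pi_w n) (FLyn_w n)"
    unfolding whitney_duals_def Pi_w_ord FLyn_w_ord
      wp.whitney_first_ord[OF unique_paths_wp] wp.whitney_second_ord[OF unique_paths_wp]
      fl.whitney_first_ord[OF unique_paths_fl] fl.whitney_second_ord[OF unique_paths_fl]
      wp.path_bottom fl.path_bottom
    using wp.graded fl.graded by (simp add: abs_mult power_abs)
  show "poset_isomorphic (FLyn_w n) (R_poset (Lambda_w n) lambda_w (Pi_w n))"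
    unfolding FLyn_w_ord R_poset_def
    by (rule poset_isomorphic_generated_order[OF bij_forest_chain]) (rule forest_chain_step)
qed

end
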